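(* Let $A\in\mathcal A$ with $\mu(A)>0$ and let $r>0$. Consider the metric projection $P_{C_A(r)}:L_p(S;X)\to C_A(r)$. (a) $P_{C_A(r)}$ is Fréchet differentiable on $C_A^o(r)$ and, for any $g\in C_A^o(r)$, $$P'_{C_A(r)}(g)(h)=h,\quad\text{for any }h\in L_p(S;X)\setminus\{\theta\}.$$ (b) $P_{C_A(r)}$ is Fréchet differentiable on $L_p(S;X)\setminus C_A(r)$ and, for any $g\in L_p(S;X)\setminus C_A(r)$, $$P'_{C_A(r)}(g)(h)=\frac{r}{\|g_A\|_{L_p(A;X)}}\left(h_A-\frac{\Psi_p(g_A,h_A)}{\|g_A\|_{L_p(A;X)}}g_A\right)+h_{S\setminus A},\quad\text{for any }h\in L_p(S;X)\setminus\{\theta\}.$$ In particular, $P'_{C_A(r)}(g)(g)=g_{S\setminus A}$ for every $g\in L_p(S;X)\setminus C_A(r)$.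
   Context: Let $(S,\mathcal A,\mu)$ be a positive measure space, $X$ a real uniformly convex and uniformly smooth Banach space, and $1<p<\infty$. $L_p(S;X)$ is the Bochner space of ($\mu$-equivalence classes of) strongly measurable $f:S\to X$ with $\|f\|_{L_p(S;X)}=\left(\int_S\|f(s)\|_X^p\,d\mu(s)\right)^{1/p}<\infty$; it is a uniformly convex and uniformly smooth Banach space. For $A\in\mathcal A$ with $\mu(A)>0$, $L_p(A;X)$ is the subspace $\{f\in L_p(S;X): f(s)=\theta \text{ for } \mu\text{-a.e. } s\in S\setminus A\}$ ($\theta$ denotes the zero vector) with the induced norm, denoted $\|\cdot\|_{L_p(A;X)}$. For $E\in\mathcal A$ and $f\in L_p(S;X)$, $f_E$ is defined by $f_E(s)=f(s)$ for $s\in E$ and $f_E(s)=\theta$ for $s\notin E$. For $r>0$: $C_A(r)=\{f\in L_p(S;X):\|f_A\|_{L_p(A;X)}\le r\}$ and $C_A^o(r)=\{f\in L_p(S;X):\|f_A\|_{L_p(A;X)}<r\}$. The function of smoothness of $L_p(S;X)$ is $\Psi_p(x,v)=\lim_{t\downarrow0}\frac{\|x+tv\|_{L_p(S;X)}-\|x\|_{L_p(S;X)}}{t}$ (this limit exists for all $x$ and $v$; $\Psi_p(x,\theta)=0$). For a nonempty closed convex subset $C$ of a uniformly convex and uniformly smooth Banach space $Z$, the metric projection $P_C:Z\to C$ assigns to $x$ the unique point $P_Cx\in C$ with $\|x-P_Cx\|\le\|x-z\|$ for all $z\in C$. $P_C$ is (Gâteaux) directionally differentiable at $x\in Z$ if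 for every $v\in Z$, $v\neq\theta$, the limit $P_C'(x)(v)=\lim_{t\downarrow0}\frac{P_C(x+tv)-P_C(x)}{t}$ exists (in norm). $P_C$ is called Fréchet differentiable at $x$ if moreover this limit is attained uniformly for $v$ in the unit sphere of $Z$; it is Fréchet differentiable on a set $D\subseteq Z$ if it is so at every point of $D$. *)

theory Defs
  imports "HOL-Analysis.Analysis"
begin

section \<open>Uniformly convex and uniformly smooth Banach spaces\<close>

definition uniformly_convex :: "'b::real_normed_vector itself \<Rightarrow> bool" where
  "uniformly_convex _ \<longleftrightarrow>
     (\<forall>\<epsilon>>0. \<exists>\<delta>>0. \<forall>x y::'b. norm x = 1 \<longrightarrow> norm y = 1 \<longrightarrow> \<epsilon> \<le> norm (x - y)
        \<longrightarrow> norm ((1/2) *\<^sub>R (x + y)) \<le> 1 - \<delta>)"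

text \<open>This says that the modulus of smoothness
  \<open>\<rho>(\<tau>) = sup {(\<parallel>x + y\<parallel> + \<parallel>x - y\<parallel>) / 2 - 1 | \<parallel>x\<parallel> = 1, \<parallel>y\<parallel> = \<tau>}\<close>
  satisfies \<open>\<rho>(\<tau>) / \<tau> \<longlongrightarrow> 0\<close> as \<open>\<tau>\<close> decreases to \<open>0\<close>.\<close>

definition uniformly_smooth :: "'b::real_normed_vector itself \<Rightarrow> bool" where
  "uniformly_smooth _ \<longleftrightarrow>
     (\<forall>\<epsilon>>0. \<exists>\<delta>>0. \<forall>x y::'b. norm x = 1 \<longrightarrow> norm y \<le> \<delta>
        \<longrightarrow> norm (x + y) + norm (x - y) \<le> 2 + \<epsilon> * norm y)"

section \<open>Normed spaces with an explicit carrier\<close>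

text \<open>The space \<open>L\<^sub>p(S; X)\<close> depends on the measure and on \<open>p\<close>, hence it cannot be an instance of
  \<open>real_normed_vector\<close>. It is represented by the following record; the notions below only
  concern the points of the carrier.\<close>

record 'z nspace =
  points :: "'z set"
  nzero :: 'z ("\<theta>\<index>")
  nadd :: "'z \<Rightarrow> 'z \<Rightarrow> 'z" (infixl "\<boxplus>\<index>" 65)
  nscale :: "real \<Rightarrow> 'z \<Rightarrow> 'z" (infixr "\<odot>\<index>" 75)
  nnorm :: "'z \<Rightarrow> real"

definition nminus :: "('z, 'm) nspace_scheme \<Rightarrow> 'z \<Rightarrow> 'z \<Rightarrow> 'z" (infixl "\<boxminus>\<index>" 65) where
  "x \<boxminus>\<^bsub>Z\<^esub> y = x \<boxplus>\<^bsub>Z\<^esub> ((-1) \<odot>\<^bsub>Z\<^esub> y)"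

definition metric_proj :: "('z, 'm) nspace_scheme \<Rightarrow> 'z set \<Rightarrow> 'z \<Rightarrow> 'z" where
  "metric_proj Z C x = (THE y. y \<in> C \<and> (\<forall>z\<in>C. nnorm Z (x \<boxminus>\<^bsub>Z\<^esub> y) \<le> nnorm Z (x \<boxminus>\<^bsub>Z\<^esub> z)))"

definition smoothness_fun :: "('z, 'm) nspace_scheme \<Rightarrow> 'z \<Rightarrow> 'z \<Rightarrow> real" where
  "smoothness_fun Z x v =
     Lim (at_right 0) (\<lambda>t. (nnorm Z (x \<boxplus>\<^bsub>Z\<^esub> (t \<odot>\<^bsub>Z\<^esub> v)) - nnorm Z x) / t)"

definition diff_quot :: "('z, 'm) nspace_scheme \<Rightarrow> ('z \<Rightarrow> 'z) \<Rightarrow> 'z \<Rightarrow> 'z \<Rightarrow> real \<Rightarrow> 'z" where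
  "diff_quot Z F x v t = (1 / t) \<odot>\<^bsub>Z\<^esub> (F (x \<boxplus>\<^bsub>Z\<^esub> (t \<odot>\<^bsub>Z\<^esub> v)) \<boxminus>\<^bsub>Z\<^esub> F x)"

definition has_dir_deriv :: "('z, 'm) nspace_scheme \<Rightarrow> ('z \<Rightarrow> 'z) \<Rightarrow> 'z \<Rightarrow> 'z \<Rightarrow> 'z \<Rightarrow> bool" where
  "has_dir_deriv Z F x v d \<longleftrightarrow>
     d \<in> points Z \<and> ((\<lambda>t. nnorm Z (diff_quot Z F x v t \<boxminus>\<^bsub>Z\<^esub> d)) \<longlongrightarrow> 0) (at_right 0)"

definition dir_deriv :: "('z, 'm) nspace_scheme \<Rightarrow> ('z \<Rightarrow> 'z) \<Rightarrow> 'z \<Rightarrow> 'z \<Rightarrow> 'z" where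
  "dir_deriv Z F x v = (THE d. has_dir_deriv Z F x v d)"

definition dir_differentiable_at :: "('z, 'm) nspace_scheme \<Rightarrow> ('z \<Rightarrow> 'z) \<Rightarrow> 'z \<Rightarrow> bool" where
  "dir_differentiable_at Z F x \<longleftrightarrow> (\<forall>v\<in>points Z - {\<theta>\<^bsub>Z\<^esub>}. \<exists>d. has_dir_deriv Z F x v d)"

text \<open>No linearity of \<open>v \<mapsto> dir_deriv Z F x v\<close> is required.\<close>

definition frechet_differentiable_at :: "('z, 'm) nspace_scheme \<Rightarrow> ('z \<Rightarrow> 'z) \<Rightarrow> 'z \<Rightarrow> bool" where
  "frechet_differentiable_at Z F x \<longleftrightarrow>
     dir_differentiable_at Z F x \<and>
     (\<forall>\<epsilon>>0. \<exists>\<delta>>0. \<forall>v\<in>points Z. nnorm Z v = 1 \<longrightarrow>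
        (\<forall>t\<in>{0<..<\<delta>}. nnorm Z (diff_quot Z F x v t \<boxminus>\<^bsub>Z\<^esub> dir_deriv Z F x v) < \<epsilon>))"

definition frechet_differentiable_on :: "('z, 'm) nspace_scheme \<Rightarrow> ('z \<Rightarrow> 'z) \<Rightarrow> 'z set \<Rightarrow> bool" where
  "frechet_differentiable_on Z F D \<longleftrightarrow> (\<forall>x\<in>D. frechet_differentiable_at Z F x)"

section \<open>The Bochner space \<open>L\<^sub>p(S; X)\<close>\<close>

text \<open>The target space need not be separable, so Borel measurability would be too weak here.\<close>

definition strongly_measurable :: "'a measure \<Rightarrow> ('a \<Rightarrow> 'b::real_normed_vector) \<Rightarrow> bool" where
  "strongly_measurable M f \<longleftrightarrow>
     (\<exists>u. (\<forall>n::nat. simple_function M (u n)) \<and> (\<forall>s\<in>space M. (\<lambda>n. u n s) \<longlonglongrightarrow> f s))"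

definition Lp_fun :: "'a measure \<Rightarrow> real \<Rightarrow> ('a \<Rightarrow> 'b::real_normed_vector) set" where
  "Lp_fun M p = {f. strongly_measurable M f \<and> integrable M (\<lambda>s. norm (f s) powr p)}"

definition Lp_rel :: "'a measure \<Rightarrow> real \<Rightarrow> (('a \<Rightarrow> 'b::real_normed_vector) \<times> ('a \<Rightarrow> 'b)) set" where
  "Lp_rel M p = {(f, g). f \<in> Lp_fun M p \<and> g \<in> Lp_fun M p \<and> (AE s in M. f s = g s)}"

definition Lp_class :: "'a measure \<Rightarrow> real \<Rightarrow> ('a \<Rightarrow> 'b::real_normed_vector) \<Rightarrow> ('a \<Rightarrow> 'b) set" where
  "Lp_class M p f = Lp_rel M p `` {f}"

definition Lp_rep :: "('a \<Rightarrow> 'b) set \<Rightarrow> 'a \<Rightarrow> 'b" where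
  "Lp_rep G = (SOME f. f \<in> G)"

definition Lp :: "'a measure \<Rightarrow> real \<Rightarrow> ('a \<Rightarrow> 'b::real_normed_vector) set nspace" where
  "Lp M p =
     \<lparr> points = Lp_fun M p // Lp_rel M p,
       nzero = Lp_class M p (\<lambda>_. 0),
       nadd = (\<lambda>G H. Lp_class M p (\<lambda>s. Lp_rep G s + Lp_rep H s)),
       nscale = (\<lambda>c G. Lp_class M p (\<lambda>s. c *\<^sub>R Lp_rep G s)),
       nnorm = (\<lambda>G. (\<integral>s. norm (Lp_rep G s) powr p \<partial>M) powr (1 / p)) \<rparr>"

text \<open>The subspace \<open>L\<^sub>p(A; X)\<close> with the induced norm.\<close>

definition Lp_on :: "'a measure \<Rightarrow> real \<Rightarrow> 'a set \<Rightarrow> ('a \<Rightarrow> 'b::real_normed_vector) set nspace" where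
  "Lp_on M p A =
     Lp M p \<lparr> points := {G \<in> points (Lp M p). AE s in M. s \<notin> A \<longrightarrow> Lp_rep G s = 0} \<rparr>"

text \<open>\<open>Lp_restrict M p E G\<close> is the class \<open>G\<^sub>E\<close>.\<close>

definition Lp_restrict ::
    "'a measure \<Rightarrow> real \<Rightarrow> 'a set \<Rightarrow> ('a \<Rightarrow> 'b::real_normed_vector) set \<Rightarrow> ('a \<Rightarrow> 'b) set" where
  "Lp_restrict M p E G = Lp_class M p (\<lambda>s. if s \<in> E then Lp_rep G s else 0)"

definition Lp_cyl ::
    "'a measure \<Rightarrow> real \<Rightarrow> 'a set \<Rightarrow> real \<Rightarrow> ('a \<Rightarrow> 'b::real_normed_vector) set set" where
  "Lp_cyl M p A r = {G \<in> points (Lp M p). nnorm (Lp_on M p A) (Lp_restrict M p A G) \<le> r}"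

definition Lp_open_cyl ::
    "'a measure \<Rightarrow> real \<Rightarrow> 'a set \<Rightarrow> real \<Rightarrow> ('a \<Rightarrow> 'b::real_normed_vector) set set" where
  "Lp_open_cyl M p A r = {G \<in> points (Lp M p). nnorm (Lp_on M p A) (Lp_restrict M p A G) < r}"

end

theory Submission
  imports Defs
begin

text \<open>
  The projection onto the cylinder scales \<open>f\<close> radially on \<open>A\<close> and leaves it unchanged off \<open>A\<close>:
  it is the identity inside, and \<open>(r / \<parallel>f\<^sub>A\<parallel>) f\<^sub>A + f\<^bsub>S - A\<^esub>\<close> outside. Minimality is the triangle inequality,
  and uniqueness comes from the strict convexity of \<open>x \<mapsto> \<parallel>x\<parallel>\<^sup>p\<close> at midpoints, integrated over \<open>S\<close>.
  Outside the cylinder everything thus reduces to the Frechet differentiability of the \<open>L\<^sub>p\<close> norm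
  away from \<open>0\<close>, that is, to \<open>\<parallel>f + t v\<parallel> + \<parallel>f - t v\<parallel> - 2 \<parallel>f\<parallel> \<le> \<epsilon> t\<close> for small \<open>t\<close>, uniformly in
  bounded \<open>v\<close>. Uniform smoothness of \<open>X\<close> gives the pointwise estimate
  \<open>\<parallel>a + t b\<parallel>\<^sup>p + \<parallel>a - t b\<parallel>\<^sup>p - 2 \<parallel>a\<parallel>\<^sup>p \<le> \<epsilon> t (\<parallel>a\<parallel>\<^sup>p + \<parallel>b\<parallel>\<^sup>p) + K t\<^sup>p \<parallel>b\<parallel>\<^sup>p\<close>, which is integrated, and the
  passage from \<open>p\<close>-th powers to norms costs only the tangent inequality for the \<open>p\<close>-th power.
\<close>

section \<open>Powers of norms and convex functions\<close>

text \<open>Mean value theorem on either side of \<open>a\<close>, with strict monotonicity of the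
  derivative. The case \<open>s = 0\<close> is separate because the derivative is only available at
  positive points; there \<open>0 powr p = 0\<close> and the claim becomes
  \<open>1 - p < 0\<close>.\<close>

lemma powr_tangent_less:
  fixes a s p :: real
  assumes "1 < p" "0 < a" "0 \<le> s" "s \<noteq> a"
  shows "a powr p + p * a powr (p - 1) * (s - a) < s powr p"
proof -
  have deriv: "((\<lambda>x. x powr p) has_real_derivative p * x powr (p - 1)) (at x)" if "x > 0" for x
    using that by (auto intro!: derivative_eq_intros)
  have a_powr: "a * a powr (p - 1) = a powr p"
    using assms by (simp add: powr_mult_base)
  consider "s = 0" | "0 < s" "s < a" | "a < s"
    using assms by linarith
  then show ?thesis
  proof cases
    case 1
    have "a powr p * (1 - p) < 0"
      using assms by (simp add: mult_pos_neg)
    moreover have "a powr p + p * a powr (p - 1) * (0 - a) = a powr p - p * (a * a powr (p - 1))"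
      by (simp add: algebra_simps)
    ultimately show ?thesis
      using 1 assms a_powr by (simp add: algebra_simps)
  next
    case 2
    obtain z where z: "s < z" "z < a" "a powr p - s powr p = (a - s) * (p * z powr (p - 1))"
      using MVT2[of s a "\<lambda>x. x powr p" "\<lambda>x. p * x powr (p - 1)"] 2 deriv by fastforce
    have "z powr (p - 1) < a powr (p - 1)"
      using z 2 assms by (intro powr_less_mono2) auto
    then have "(a - s) * (p * z powr (p - 1)) < (a - s) * (p * a powr (p - 1))"
      using 2 assms by (intro mult_strict_left_mono) auto
    then show ?thesis
      using z by (simp add: algebra_simps)
  next
    case 3
    obtain z where z: "a < z" "z < s" "s powr p - a powr p = (s - a) * (p * z powr (p - 1))"
      using MVT2[of a s "\<lambda>x. x powr p" "\<lambda>x. p * x powr (p - 1)"] 3 deriv assms by fastforce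
    have "a powr (p - 1) < z powr (p - 1)"
      using z 3 assms by (intro powr_less_mono2) auto
    then have "(s - a) * (p * a powr (p - 1)) < (s - a) * (p * z powr (p - 1))"
      using 3 assms by (intro mult_strict_left_mono) auto
    then show ?thesis
      using z by (simp add: algebra_simps)
  qed
qed

lemma powr_tangent_le:
  fixes a s p :: real
  assumes "1 < p" "0 < a" "0 \<le> s"
  shows "a powr p + p * a powr (p - 1) * (s - a) \<le> s powr p"
  using powr_tangent_less[OF assms] by (cases "s = a") auto

text \<open>Average the tangent inequalities at the convex combination \<open>z\<close>: the linear
  terms cancel. The tangent inequality asks for a positive base point, so \<open>z = 0\<close> is
  treated apart.\<close>

lemma convex_on_powr_nonneg:
  fixes p :: real
  assumes "1 < p"
  shows "convex_on {0..} (\<lambda>x. x powr p)"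
proof (intro convex_onI)
  fix t x y :: real
  assume t: "0 < t" "t < 1" and x: "x \<in> {0..}" and y: "y \<in> {0..}"
  define z where "z = (1 - t) * x + t * y"
  have "z powr p \<le> (1 - t) * x powr p + t * y powr p"
  proof (cases "z = 0")
    case True
    then show ?thesis using t by simp
  next
    case False
    moreover have "0 \<le> z" unfolding z_def using t x y by simp
    ultimately have z: "0 < z" by simp
    define c where "c = p * z powr (p - 1)"
    have "(1 - t) * (z powr p + c * (x - z)) \<le> (1 - t) * x powr p"
      using powr_tangent_le[OF assms z, of x] t x by (intro mult_left_mono) (auto simp: c_def)
    moreover have "t * (z powr p + c * (y - z)) \<le> t * y powr p"
      using powr_tangent_le[OF assms z, of y] t y by (intro mult_left_mono) (auto simp: c_def)
    moreover have "(1 - t) * (z powr p + c * (x - z)) + t * (z powr p + c * (y - z))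
        = z powr p + c * ((1 - t) * x + t * y - z)"
      by (simp add: algebra_simps)
    moreover have "\<dots> = z powr p" by (simp add: z_def)
    ultimately show ?thesis by linarith
  qed
  then show "((1 - t) *\<^sub>R x + t *\<^sub>R y) powr p \<le> (1 - t) * x powr p + t * y powr p"
    by (simp add: z_def)
qed auto

text \<open>Strict tangent inequalities at the midpoint, which is positive and differs from both
  points since \<open>s\<close> and \<open>t\<close> are distinct and nonnegative.\<close>

lemma powr_midpoint_less:
  fixes s t p :: real
  assumes "1 < p" "0 \<le> s" "0 \<le> t" "s \<noteq> t"
  shows "((s + t) / 2) powr p < (s powr p + t powr p) / 2"
proof -
  define m where "m = (s + t) / 2"
  have m: "0 < m" "s \<noteq> m" "t \<noteq> m" using assms by (auto simp: m_def)
  define c where "c = p * m powr (p - 1)"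
  have "m powr p + c * (s - m) < s powr p" "m powr p + c * (t - m) < t powr p"
    using powr_tangent_less[OF assms(1) m(1)] assms m by (auto simp: c_def)
  moreover have "c * (s - m) + c * (t - m) = c * (s + t - 2 * m)"
    by (simp add: algebra_simps)
  moreover have "\<dots> = 0" by (simp add: m_def)
  ultimately have "2 * m powr p < s powr p + t powr p" by linarith
  then show ?thesis by (simp add: m_def)
qed

lemma powr_convex_combination:
  fixes p l s t :: real
  assumes "1 < p" "0 \<le> l" "l \<le> 1" "0 \<le> s" "0 \<le> t"
  shows "((1 - l) * s + l * t) powr p \<le> (1 - l) * s powr p + l * t powr p"
  using convex_onD[OF convex_on_powr_nonneg[OF assms(1)], of l s t] assms by simp

section \<open>Midpoint convexity of the p-th power of a norm, with its equality case\<close>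

lemma norm_midpoint_powr_le:
  fixes x y :: "'b::real_normed_vector"
  assumes "1 < p"
  shows "norm ((1/2) *\<^sub>R (x + y)) powr p \<le> (norm x powr p + norm y powr p) / 2"
proof -
  have "norm ((1/2) *\<^sub>R (x + y)) powr p \<le> ((norm x + norm y) / 2) powr p"
    using assms norm_triangle_ineq[of x y] by (intro powr_mono2) auto
  also have "\<dots> \<le> (norm x powr p + norm y powr p) / 2"
    using powr_convex_combination[OF assms, of "1/2" "norm x" "norm y"] by (simp add: field_simps)
  finally show ?thesis .
qed

text \<open>Only strict convexity is extracted: after scaling to the unit sphere, the modulus is
  taken at the distance of the two given vectors themselves.\<close>

lemma uniformly_convex_midpoint_less:
  fixes x y :: "'b::real_normed_vector"
  assumes "uniformly_convex TYPE('b)" "norm x = norm y" "x \<noteq> y"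
  shows "norm ((1/2) *\<^sub>R (x + y)) < norm x"
proof -
  define c where "c = norm x"
  have c: "c > 0" "norm y = c" using assms by (auto simp: c_def)
  define u v where "u = (1/c) *\<^sub>R x" and "v = (1/c) *\<^sub>R y"
  have uv: "norm u = 1" "norm v = 1" "u \<noteq> v" 
    using c assms(3) by (auto simp: u_def v_def c_def)
  then have "0 < norm (u - v)" by simp
  then obtain d where "d > 0" and "norm ((1/2) *\<^sub>R (u + v)) \<le> 1 - d"
    using assms(1) uv unfolding uniformly_convex_def by (meson order_refl)
  then have "norm ((1/2) *\<^sub>R (u + v)) < 1" by linarith
  moreover have "(1/2) *\<^sub>R (u + v) = (1/c) *\<^sub>R ((1/2) *\<^sub>R (x + y))"
    by (simp add: u_def v_def algebra_simps)
  ultimately have "norm ((1/c) *\<^sub>R ((1/2) *\<^sub>R (x + y))) < 1" by simp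
  then have "\<bar>1/c\<bar> * norm ((1/2) *\<^sub>R (x + y)) < 1" by (metis norm_scaleR)
  then show ?thesis using c by (simp add: c_def[symmetric] field_simps)
qed

text \<open>Strictness has two sources: uniform convexity of the space when the norms agree, and
  strict convexity of the real power when they do not.\<close>

lemma norm_midpoint_powr_eqD:
  fixes x y :: "'b::real_normed_vector"
  assumes "uniformly_convex TYPE('b)" "1 < p"
    and eq: "norm ((1/2) *\<^sub>R (x + y)) powr p = (norm x powr p + norm y powr p) / 2"
  shows "x = y"
proof (rule ccontr)
  assume neq: "x \<noteq> y"
  show False
  proof (cases "norm x = norm y")
    case True
    have "norm ((1/2) *\<^sub>R (x + y)) powr p < norm x powr p"
      using uniformly_convex_midpoint_less[OF assms(1) True neq] assms(2)
      by (intro powr_less_mono2) auto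
    then show False using eq True by simp
  next
    case False
    have "norm ((1/2) *\<^sub>R (x + y)) powr p \<le> ((norm x + norm y) / 2) powr p"
      using assms norm_triangle_ineq[of x y] by (intro powr_mono2) auto
    then show False
      using powr_midpoint_less[OF assms(2) _ _ False] eq by simp
  qed
qed

section \<open>Second differences of the p-th power of a uniformly smooth norm\<close>

lemma one_plus_powr_le:
  fixes p e :: real
  assumes "0 < e"
  shows "\<exists>d>0. \<forall>u. \<bar>u\<bar> \<le> d \<longrightarrow> (1 + u) powr p \<le> 1 + p * u + e * \<bar>u\<bar>"
proof -
  have "((\<lambda>x. x powr p) has_real_derivative p) (at 1)"
    by (auto intro!: derivative_eq_intros)
  then have "(\<lambda>h. ((1 + h) powr p - 1) / h) \<midarrow>0\<rightarrow> p"
    by (simp add: DERIV_def)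
  from LIM_D[OF this assms] obtain d where d: "d > 0"
    "\<And>h. h \<noteq> 0 \<Longrightarrow> \<bar>h\<bar> < d \<Longrightarrow> \<bar>((1 + h) powr p - 1) / h - p\<bar> < e"
    by auto
  show ?thesis
  \<comment> \<open>The limit controls \<open>\<bar>h\<bar> < d\<close>, while the claim has a
    closed bound; hence the half.\<close>
  proof (intro exI[of _ "d/2"] conjI allI impI)
    fix u :: real assume u: "\<bar>u\<bar> \<le> d/2"
    show "(1 + u) powr p \<le> 1 + p * u + e * \<bar>u\<bar>"
    proof (cases "u = 0")
      case False
      have eq: "((1 + u) powr p - 1) / u - p = ((1 + u) powr p - 1 - p * u) / u"
        using False by (simp add: field_simps)
      have "\<bar>(1 + u) powr p - 1 - p * u\<bar> / \<bar>u\<bar> < e"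
        using d(2)[OF False] u d(1) unfolding eq by (simp add: abs_divide)
      then show ?thesis using False by (simp add: field_simps abs_less_iff)
    qed auto
  qed (use d in auto)
qed

text \<open>If \<open>t *\<^sub>R b\<close> is small relative to \<open>a\<close>, scaling by
  \<open>norm a\<close> reduces the claim to the unit sphere, where uniform smoothness applies.
  Otherwise \<open>norm a\<close> is at most a multiple of \<open>norm (t *\<^sub>R b)\<close>, and
  the \<open>K\<close> term absorbs everything. \<open>K\<close> depends only on \<open>e\<close>,
  \<open>p\<close> and the space, so the estimate can be integrated.\<close>

lemma powr_norm_smooth_bound:
  assumes "uniformly_smooth TYPE('b::real_normed_vector)" "1 < p" "0 < e"
  shows "\<exists>K\<ge>0. \<forall>(a::'b) b t. 0 < t \<longrightarrow>
    norm (a + t *\<^sub>R b) powr p + norm (a - t *\<^sub>R b) powr p - 2 * norm a powr p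
      \<le> e * t * (norm a powr p + norm b powr p) + K * t powr p * norm b powr p"
proof -
  \<comment> \<open>Error budget: \<open>p * e1\<close> comes from uniform smoothness, and one
    \<open>e1\<close> from each of the two expansions of the power.\<close>
  define e1 where "e1 = e / (p + 2)"
  have "e1 > 0" "(p + 2) * e1 = e"
    using assms by (simp_all add: e1_def)
  then have e1: "e1 > 0" "p * e1 + 2 * e1 = e"
    by (simp_all add: distrib_right)
  obtain d1 where d1: "d1 > 0" "\<And>x y::'b. norm x = 1 \<Longrightarrow> norm y \<le> d1 \<Longrightarrow>
      norm (x + y) + norm (x - y) \<le> 2 + e1 * norm y"
    using assms(1) e1 unfolding uniformly_smooth_def by meson
  obtain d2 where d2: "d2 > 0" "\<And>u. \<bar>u\<bar> \<le> d2 \<Longrightarrow> (1 + u) powr p \<le> 1 + p * u + e1 * \<bar>u\<bar>"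
    using one_plus_powr_le[OF e1(1)] by meson
  define d where "d = min d1 d2"
  have d: "d > 0" using d1 d2 by (simp add: d_def)
  \<comment> \<open>The factor 2 accounts for the two powers on the left, each bounded by the p-th
    power of \<open>(1 / d + 1) * norm (t *\<^sub>R b)\<close>.\<close>
  define K where "K = 2 * (1 / d + 1) powr p"
  have unit: "norm (x + y) powr p + norm (x - y) powr p - 2 \<le> e * norm y"
    if x: "norm x = 1" and y: "norm y \<le> d" for x y :: 'b
  proof -
    \<comment> \<open>Each increment alone is only of order \<open>norm y\<close>; smoothness makes
      their sum small against \<open>norm y\<close>, which controls the first-order part
      \<open>p * (u + v)\<close>.\<close>
    define u v where "u = norm (x + y) - 1" and "v = norm (x - y) - 1"
    have uv: "\<bar>u\<bar> \<le> norm y" "\<bar>v\<bar> \<le> norm y"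
      using norm_triangle_ineq[of x y] norm_triangle_ineq4[of x y] norm_diff_ineq[of x y]
        norm_triangle_ineq2[of x y] x by (auto simp: u_def v_def)
    have "(1 + u) powr p \<le> 1 + p * u + e1 * \<bar>u\<bar>" "(1 + v) powr p \<le> 1 + p * v + e1 * \<bar>v\<bar>"
      using uv y by (auto intro!: d2 simp: d_def)
    moreover have "e1 * \<bar>u\<bar> \<le> e1 * norm y" "e1 * \<bar>v\<bar> \<le> e1 * norm y"
      using uv e1 by auto
    moreover have "u + v \<le> e1 * norm y"
      using d1(2)[OF x, of y] y by (simp add: u_def v_def d_def)
    then have "p * (u + v) \<le> p * (e1 * norm y)" using assms by simp
    moreover have "p * (e1 * norm y) + e1 * norm y + e1 * norm y = e * norm y"
      by (simp flip: e1(2) add: algebra_simps)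
    ultimately have "(1 + u) powr p + (1 + v) powr p - 2 \<le> e * norm y"
      by (simp add: algebra_simps)
    then show ?thesis by (simp add: u_def v_def)
  qed
  have "norm (a + t *\<^sub>R b) powr p + norm (a - t *\<^sub>R b) powr p - 2 * norm a powr p
      \<le> e * t * (norm a powr p + norm b powr p) + K * t powr p * norm b powr p"
    if t: "0 < t" for a b :: 'b and t
  proof (cases "norm (t *\<^sub>R b) \<le> d * norm a \<and> a \<noteq> 0")
    case True
    define c where "c = norm a"
    have c: "c > 0" using True by (simp add: c_def)
    define x y where "x = (1/c) *\<^sub>R a" and "y = (1/c) *\<^sub>R (t *\<^sub>R b)"
    have a: "a = c *\<^sub>R x" and tb: "t *\<^sub>R b = c *\<^sub>R y" using c by (auto simp: x_def y_def)
    have nx: "norm x = 1" using c by (simp add: x_def c_def)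
    have cy: "norm y = t * norm b / c" using c t by (simp add: y_def)
    have ny: "norm y \<le> d" using True c by (simp add: y_def c_def field_simps)
    have "a + t *\<^sub>R b = c *\<^sub>R (x + y)" "a - t *\<^sub>R b = c *\<^sub>R (x - y)"
      by (simp_all only: a tb scaleR_add_right scaleR_diff_right)
    then have "norm (a + t *\<^sub>R b) = c * norm (x + y)" "norm (a - t *\<^sub>R b) = c * norm (x - y)"
      using c by simp_all
    then have "norm (a + t *\<^sub>R b) powr p + norm (a - t *\<^sub>R b) powr p - 2 * norm a powr p
        = c powr p * (norm (x + y) powr p + norm (x - y) powr p - 2)"
      using c by (simp add: powr_mult algebra_simps flip: c_def)
    also have "\<dots> \<le> c powr p * (e * norm y)"
      using unit[OF nx ny] by (intro mult_left_mono) auto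
    also have "\<dots> = e * t * (c powr p * (norm b / c))" by (simp add: cy)
    also have "\<dots> \<le> e * t * (c powr p + norm b powr p)"
    proof (intro mult_left_mono)
      \<comment> \<open>A crude Young inequality: the product of \<open>c powr (p - 1)\<close> and
        \<open>norm b\<close> is at most the p-th power of the larger of \<open>c\<close> and
        \<open>norm b\<close>.\<close>
      show "c powr p * (norm b / c) \<le> c powr p + norm b powr p"
      proof (cases "norm b \<le> c")
        case True
        then have "c powr p * (norm b / c) \<le> c powr p * 1"
          using c by (intro mult_left_mono) auto
        then show ?thesis by (simp add: add_increasing2)
      next
        case False
        have "c powr p * (norm b / c) = c powr (p - 1) * norm b"
          using c by (simp add: powr_diff)
        also have "\<dots> \<le> norm b powr (p - 1) * norm b"
          using c False assms by (intro mult_right_mono powr_mono2) auto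
        also have "\<dots> = norm b powr p"
          using False c by (simp add: powr_mult_base mult.commute)
        finally show ?thesis by (simp add: add_increasing)
      qed
    qed (use assms t in auto)
    also have "\<dots> \<le> \<dots> + K * t powr p * norm b powr p"
      by (simp add: K_def)
    finally show ?thesis by (simp add: c_def)
  next
    case False
    define z where "z = norm (t *\<^sub>R b)"
    \<comment> \<open>This also covers \<open>a = 0\<close>, where the left side vanishes.\<close>
    have "norm a \<le> (1 / d) * z" using False d by (auto simp: z_def field_simps)
    then have "norm (a + t *\<^sub>R b) \<le> (1 / d + 1) * z" "norm (a - t *\<^sub>R b) \<le> (1 / d + 1) * z"
      using norm_triangle_ineq[of a "t *\<^sub>R b"] norm_triangle_ineq4[of a "t *\<^sub>R b"]
      unfolding z_def[symmetric] by (auto simp: algebra_simps)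
    then have "norm (a + t *\<^sub>R b) powr p \<le> ((1 / d + 1) * z) powr p"
      "norm (a - t *\<^sub>R b) powr p \<le> ((1 / d + 1) * z) powr p"
      using assms by (auto intro!: powr_mono2)
    moreover have "((1 / d + 1) * z) powr p = (1 / d + 1) powr p * (t powr p * norm b powr p)"
      using d t by (simp add: z_def powr_mult)
    moreover have "0 \<le> e * t * (norm a powr p + norm b powr p)" "0 \<le> norm a powr p"
      using assms t by auto
    moreover have "K * t powr p * norm b powr p = 2 * ((1 / d + 1) powr p * (t powr p * norm b powr p))"
      by (simp add: K_def)
    ultimately show ?thesis by linarith
  qed
  moreover have "K \<ge> 0" by (simp add: K_def)
  ultimately show ?thesis by blast
qed

section \<open>One-sided derivatives of convex functions\<close>

text \<open>Right difference quotients increase with \<open>t\<close> and lie above every left one.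
  Hence they converge to their infimum, so \<open>Lim\<close> is a genuine limit, and the infimum
  inherits both bounds.\<close>

lemma convex_right_derivative_bounds:
  fixes f :: "real \<Rightarrow> real"
  assumes "convex_on UNIV f" "0 < t"
  shows "(f 0 - f (- t)) / t \<le> Lim (at_right 0) (\<lambda>t. (f t - f 0) / t)"
    and "Lim (at_right 0) (\<lambda>t. (f t - f 0) / t) \<le> (f t - f 0) / t"
proof -
  define q where "q = (\<lambda>t. (f t - f 0) / t)"
  have below: "(f 0 - f (- s)) / s \<le> q t" if "0 < s" "0 < t" for s t
  proof -
    \<comment> \<open>The weight that expresses 0 as a convex combination of \<open>- s\<close> and
      \<open>t\<close>.\<close>
    define l where "l = s / (s + t)"
    have l: "0 \<le> l" "l \<le> 1" "(1 - l) * (- s) + l * t = 0" "(s + t) * l = s" "(s + t) * (1 - l) = t"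
      using that by (auto simp: l_def field_simps)
    then have "f 0 \<le> (1 - l) * f (- s) + l * f t"
      using convex_onD[OF assms(1), of l "-s" t] by simp
    then have "(s + t) * f 0 \<le> (s + t) * ((1 - l) * f (- s) + l * f t)"
      using that by (intro mult_left_mono) auto
    also have "\<dots> = ((s + t) * (1 - l)) * f (- s) + ((s + t) * l) * f t"
      by (simp add: algebra_simps)
    finally have "(s + t) * f 0 \<le> t * f (- s) + s * f t"
      by (simp only: l)
    then show ?thesis
      using that by (simp add: q_def field_simps)
  qed
  have mono: "q s \<le> q t" if "0 < s" "s \<le> t" for s t
  proof -
    define l where "l = s / t"
    have l: "0 \<le> l" "l \<le> 1" "l * t = s" using that by (auto simp: l_def)
    have "f s \<le> (1 - l) * f 0 + l * f t"
      using convex_onD[OF assms(1), of l 0 t] l by simp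
    then have "f s - f 0 \<le> l * (f t - f 0)" by (simp add: algebra_simps)
    then show ?thesis using that by (simp add: q_def l_def field_simps)
  qed
  define i where "i = Inf (q ` {0<..})"
  have bdd: "bdd_below (q ` {0<..})"
    using below[of 1] by (intro bdd_belowI2[of _ "(f 0 - f (- 1)) / 1"]) simp
  have le: "i \<le> q t" if "0 < t" for t
    unfolding i_def using that bdd by (intro cInf_lower imageI) simp_all
  have "(q \<longlongrightarrow> i) (at_right 0)"
  proof (rule order_tendstoI)
    fix b assume "b < i"
    then show "\<forall>\<^sub>F x in at_right 0. b < q x"
      using le by (intro eventually_at_rightI[of 0 1]) (auto intro: less_le_trans)
  next
    fix b assume "i < b"
    then obtain t where t: "0 < t" "q t < b"
      unfolding i_def using cInf_lessD[of "q ` {0<..}" b] by auto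
    then show "\<forall>\<^sub>F x in at_right 0. q x < b"
      using mono by (intro eventually_at_rightI[of 0 t]) (auto intro: le_less_trans[of _ "q t"])
  qed
  then have "Lim (at_right 0) q = i"
    by (intro tendsto_Lim) auto
  moreover have "(f 0 - f (- t)) / t \<le> i"
    unfolding i_def using below assms(2) by (intro cInf_greatest) auto
  ultimately show "(f 0 - f (- t)) / t \<le> Lim (at_right 0) (\<lambda>t. (f t - f 0) / t)"
    and "Lim (at_right 0) (\<lambda>t. (f t - f 0) / t) \<le> (f t - f 0) / t"
    using le[OF assms(2)] by (simp_all add: q_def)
qed

section \<open>The seminorm of \<open>L\<^sub>p\<close> on functions\<close>

lemma strongly_measurable_add:
  assumes "strongly_measurable M f" "strongly_measurable M g"
  shows "strongly_measurable M (\<lambda>s. f s + g s)"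
proof -
  obtain u v where
    "\<forall>n::nat. simple_function M (u n)" "\<forall>s\<in>space M. (\<lambda>n. u n s) \<longlonglongrightarrow> f s"
    "\<forall>n::nat. simple_function M (v n)" "\<forall>s\<in>space M. (\<lambda>n. v n s) \<longlonglongrightarrow> g s"
    using assms unfolding strongly_measurable_def by auto
  then show ?thesis unfolding strongly_measurable_def
    by (intro exI[of _ "\<lambda>n s. u n s + v n s"])
       (auto intro: simple_function_compose2[where h = "(+)"] tendsto_add)
qed

lemma strongly_measurable_scaleR:
  assumes "strongly_measurable M f"
  shows "strongly_measurable M (\<lambda>s. c *\<^sub>R f s)"
proof -
  obtain u where
    "\<forall>n::nat. simple_function M (u n)" "\<forall>s\<in>space M. (\<lambda>n. u n s) \<longlonglongrightarrow> f s"
    using assms unfolding strongly_measurable_def by auto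
  then show ?thesis unfolding strongly_measurable_def
    by (intro exI[of _ "\<lambda>n s. c *\<^sub>R u n s"])
       (auto intro: simple_function_compose1[where g = "(*\<^sub>R) c"] tendsto_scaleR)
qed

lemma strongly_measurable_If_set:
  assumes "strongly_measurable M f" "strongly_measurable M g" "E \<in> sets M"
  shows "strongly_measurable M (\<lambda>s. if s \<in> E then f s else g s)"
proof -
  obtain u v where
    "\<forall>n::nat. simple_function M (u n)" "\<forall>s\<in>space M. (\<lambda>n. u n s) \<longlonglongrightarrow> f s"
    "\<forall>n::nat. simple_function M (v n)" "\<forall>s\<in>space M. (\<lambda>n. v n s) \<longlonglongrightarrow> g s"
    using assms unfolding strongly_measurable_def by auto
  then show ?thesis unfolding strongly_measurable_def
    using assms(3)
    by (intro exI[of _ "\<lambda>n s. if s \<in> E then u n s else v n s"])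
       (auto intro!: simple_function_If_set)
qed

lemma strongly_measurable_zero: "strongly_measurable M (\<lambda>_. 0)"
  unfolding strongly_measurable_def by (intro exI[of _ "\<lambda>n s. 0"]) auto

lemma borel_measurable_norm_strongly_measurable:
  assumes "strongly_measurable M f"
  shows "(\<lambda>s. norm (f s)) \<in> borel_measurable M"
proof -
  obtain u where u:
    "\<forall>n::nat. simple_function M (u n)" "\<forall>s\<in>space M. (\<lambda>n. u n s) \<longlonglongrightarrow> f s"
    using assms unfolding strongly_measurable_def by auto
  show ?thesis
  proof (rule borel_measurable_LIMSEQ_metric)
    show "(\<lambda>s. norm (u n s)) \<in> borel_measurable M" for n
      using u by (intro borel_measurable_simple_function simple_function_compose1[where g = norm]) auto
    show "(\<lambda>n. norm (u n s)) \<longlonglongrightarrow> norm (f s)" if "s \<in> space M" for s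
      using u that by (auto intro: tendsto_norm)
  qed
qed

section \<open>Functions with integrable p-th power form a vector space\<close>

lemma Lp_funD:
  assumes "f \<in> Lp_fun M p"
  shows "strongly_measurable M f" "integrable M (\<lambda>s. norm (f s) powr p)"
  using assms by (auto simp: Lp_fun_def)

lemma borel_measurable_Lp_fun [measurable_dest]:
  assumes "f \<in> Lp_fun M p"
  shows "(\<lambda>s. norm (f s)) \<in> borel_measurable M"
  using borel_measurable_norm_strongly_measurable Lp_funD(1)[OF assms] .

lemma Lp_fun_bound:
  assumes "strongly_measurable M f" "integrable M g" "\<And>s. norm (f s) powr p \<le> g s"
  shows "f \<in> Lp_fun M p"
proof -
  have [measurable]: "(\<lambda>s. norm (f s)) \<in> borel_measurable M"
    using assms(1) by (rule borel_measurable_norm_strongly_measurable)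
  have "integrable M (\<lambda>s. norm (f s) powr p)"
    using assms(2)
  proof (rule Bochner_Integration.integrable_bound)
    show "AE s in M. norm (norm (f s) powr p) \<le> norm (g s)"
      using assms(3) by (auto intro!: AE_I2 order_trans[OF _ abs_ge_self])
  qed measurable
  then show ?thesis using assms by (simp add: Lp_fun_def)
qed

lemma Lp_fun_zero: "(\<lambda>_. 0) \<in> Lp_fun M p"
  by (auto simp: Lp_fun_def strongly_measurable_zero)

lemma Lp_fun_scaleR:
  assumes "f \<in> Lp_fun M p"
  shows "(\<lambda>s. c *\<^sub>R f s) \<in> Lp_fun M p"
  using assms by (auto simp: Lp_fun_def strongly_measurable_scaleR powr_mult)

text \<open>The midpoint comes first, because convexity dominates its p-th power by the average of
  the two; doubling then gives the sum.\<close>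

lemma Lp_fun_add:
  assumes "1 < p" "f \<in> Lp_fun M p" "g \<in> Lp_fun M p"
  shows "(\<lambda>s. f s + g s) \<in> Lp_fun M p"
proof -
  have "(\<lambda>s. (1/2) *\<^sub>R (f s + g s)) \<in> Lp_fun M p"
  proof (rule Lp_fun_bound)
    show "norm ((1/2) *\<^sub>R (f s + g s)) powr p \<le> (norm (f s) powr p + norm (g s) powr p) / 2" for s
      using norm_midpoint_powr_le[OF assms(1)] .
  qed (use assms in \<open>auto simp: Lp_fun_def intro!: strongly_measurable_scaleR strongly_measurable_add\<close>)
  from Lp_fun_scaleR[OF this, of 2] show ?thesis by simp
qed

lemma Lp_fun_diff:
  assumes "1 < p" "f \<in> Lp_fun M p" "g \<in> Lp_fun M p"
  shows "(\<lambda>s. f s - g s) \<in> Lp_fun M p"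
  using Lp_fun_add[OF assms(1,2) Lp_fun_scaleR[OF assms(3), of "-1"]] by simp

lemma Lp_fun_If:
  assumes "f \<in> Lp_fun M p" "g \<in> Lp_fun M p" "E \<in> sets M"
  shows "(\<lambda>s. if s \<in> E then f s else g s) \<in> Lp_fun M p"
proof (rule Lp_fun_bound)
  show "norm (if s \<in> E then f s else g s) powr p \<le> norm (f s) powr p + norm (g s) powr p" for s
    by auto
qed (use assms in \<open>auto simp: Lp_fun_def intro!: strongly_measurable_If_set\<close>)

lemmas Lp_fun_intros = Lp_fun_zero Lp_fun_scaleR Lp_fun_add Lp_fun_diff Lp_fun_If

section \<open>The seminorm and Minkowski's inequality\<close>

text \<open>Defined on functions instead of classes, so that all analysis is done on
  representatives; the passage to classes is made only at the end.\<close>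

definition Lp_norm :: "'a measure \<Rightarrow> real \<Rightarrow> ('a \<Rightarrow> 'b::real_normed_vector) \<Rightarrow> real" where
  "Lp_norm M p f = (\<integral>s. norm (f s) powr p \<partial>M) powr (1 / p)"

lemma Lp_norm_nonneg [simp]: "0 \<le> Lp_norm M p f"
  by (simp add: Lp_norm_def)

lemma Lp_norm_powr:
  assumes "1 < p"
  shows "Lp_norm M p f powr p = (\<integral>s. norm (f s) powr p \<partial>M)"
  using assms by (simp add: Lp_norm_def powr_powr)

lemma Lp_norm_le_iff:
  assumes "1 < p" "0 \<le> c"
  shows "Lp_norm M p f \<le> c \<longleftrightarrow> (\<integral>s. norm (f s) powr p \<partial>M) \<le> c powr p"
  unfolding Lp_norm_powr[OF assms(1), symmetric]
  using powr_mono2[of p "Lp_norm M p f" c] powr_less_mono2[of p c "Lp_norm M p f"] assms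
  by fastforce

lemma Lp_norm_mono:
  assumes "1 < p" "g \<in> Lp_fun M p" "f \<in> Lp_fun M p" "\<And>s. s \<in> space M \<Longrightarrow> norm (f s) \<le> norm (g s)"
  shows "Lp_norm M p f \<le> Lp_norm M p g"
  unfolding Lp_norm_def using assms
  by (intro powr_mono2 integral_mono) (auto simp: Lp_fun_def intro!: powr_mono2)

lemma Lp_norm_cong_AE:
  assumes "f \<in> Lp_fun M p" "g \<in> Lp_fun M p" "AE s in M. f s = g s"
  shows "Lp_norm M p f = Lp_norm M p g"
proof -
  have "(\<integral>s. norm (f s) powr p \<partial>M) = (\<integral>s. norm (g s) powr p \<partial>M)"
    using assms by (intro integral_cong_AE) (auto simp: Lp_fun_def)
  then show ?thesis by (simp add: Lp_norm_def)
qed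

lemma Lp_norm_eq_0_iff:
  assumes "1 < p" "f \<in> Lp_fun M p"
  shows "Lp_norm M p f = 0 \<longleftrightarrow> (AE s in M. f s = 0)"
proof -
  have "Lp_norm M p f = 0 \<longleftrightarrow> (\<integral>s. norm (f s) powr p \<partial>M) = 0"
    by (simp add: Lp_norm_def)
  also have "\<dots> \<longleftrightarrow> (AE s in M. norm (f s) powr p = 0)"
    using assms by (intro integral_nonneg_eq_0_iff_AE) (auto simp: Lp_fun_def)
  finally show ?thesis by simp
qed

lemma Lp_norm_zero [simp]: "Lp_norm M p (\<lambda>_. 0) = 0"
  by (simp add: Lp_norm_def)

lemma Lp_norm_scaleR:
  assumes "1 < p"
  shows "Lp_norm M p (\<lambda>s. c *\<^sub>R f s) = \<bar>c\<bar> * Lp_norm M p f"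
  using assms by (simp add: Lp_norm_def powr_mult powr_powr)

text \<open>Minkowski's inequality: \<open>f + g\<close> is the convex combination, with weights \<open>a / (a + b)\<close> and
  \<open>b / (a + b)\<close>, of two functions whose norms are both \<open>a + b\<close>, and the \<open>p\<close>-th power is convex.\<close>

lemma Lp_norm_triangle:
  assumes "1 < p" "f \<in> Lp_fun M p" "g \<in> Lp_fun M p"
  shows "Lp_norm M p (\<lambda>s. f s + g s) \<le> Lp_norm M p f + Lp_norm M p g"
proof -
  note fg = Lp_fun_add[OF assms]
  define a b where "a = Lp_norm M p f" and "b = Lp_norm M p g"
  have ab: "0 \<le> a" "0 \<le> b" by (auto simp: a_def b_def)
  consider "a = 0" | "b = 0" | "0 < a" "0 < b" using ab by linarith
  then show ?thesis
  proof cases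
    case 1
    then have "AE s in M. f s = 0" using assms by (simp add: a_def Lp_norm_eq_0_iff)
    then have "Lp_norm M p (\<lambda>s. f s + g s) = b"
      unfolding b_def using fg assms by (intro Lp_norm_cong_AE) auto
    then show ?thesis using ab by (simp add: a_def b_def)
  next
    case 2
    then have "AE s in M. g s = 0" using assms by (simp add: b_def Lp_norm_eq_0_iff)
    then have "Lp_norm M p (\<lambda>s. f s + g s) = a"
      unfolding a_def using fg assms by (intro Lp_norm_cong_AE) auto
    then show ?thesis using ab by (simp add: a_def b_def)
  next
    case 3
    define l where "l = b / (a + b)"
    define c d where "c = (1 - l) * ((a + b) / a) powr p" and "d = l * ((a + b) / b) powr p"
    have l: "0 < l" "l < 1" "(1 - l) * ((a + b) / a) = 1" "l * ((a + b) / b) = 1"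
    proof -
      have "1 - l = a / (a + b)" using 3 by (simp add: l_def diff_divide_eq_iff)
      then show "(1 - l) * ((a + b) / a) = 1" using 3 by simp
    qed (use 3 in \<open>simp_all add: l_def\<close>)
    have pointwise: "norm (f s + g s) powr p \<le> c * norm (f s) powr p + d * norm (g s) powr p" for s
    proof -
      define x y where "x = (a + b) / a * norm (f s)" and "y = (a + b) / b * norm (g s)"
      have "norm (f s) = ((1 - l) * ((a + b) / a)) * norm (f s)" "norm (g s) = (l * ((a + b) / b)) * norm (g s)"
        by (simp_all only: l mult_1_left)
      then have xy: "norm (f s) = (1 - l) * x" "norm (g s) = l * y"
        by (simp_all only: x_def y_def mult.assoc)
      have "0 \<le> x" "0 \<le> y" using 3 by (auto simp: x_def y_def)
      have "norm (f s + g s) powr p \<le> ((1 - l) * x + l * y) powr p"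
        unfolding xy[symmetric] using assms by (intro powr_mono2 norm_triangle_ineq) auto
      also have "\<dots> \<le> (1 - l) * x powr p + l * y powr p"
        using assms l \<open>0 \<le> x\<close> \<open>0 \<le> y\<close> by (intro powr_convex_combination) auto
      also have "\<dots> = c * norm (f s) powr p + d * norm (g s) powr p"
      proof -
        have "x powr p = ((a + b) / a) powr p * norm (f s) powr p"
          "y powr p = ((a + b) / b) powr p * norm (g s) powr p"
          using 3 unfolding x_def y_def by (simp_all only: powr_mult)
        then show ?thesis by (simp add: c_def d_def)
      qed
      finally show ?thesis .
    qed
    have "(\<integral>s. norm (f s + g s) powr p \<partial>M) \<le> (\<integral>s. c * norm (f s) powr p + d * norm (g s) powr p \<partial>M)"
      using assms fg pointwise by (intro integral_mono) (auto simp: Lp_fun_def)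
    also have "\<dots> = c * (\<integral>s. norm (f s) powr p \<partial>M) + d * (\<integral>s. norm (g s) powr p \<partial>M)"
      using assms by (auto simp: Lp_fun_def)
    also have "\<dots> = c * a powr p + d * b powr p"
      using assms by (simp add: a_def b_def Lp_norm_powr)
    also have "\<dots> = (1 - l) * (a + b) powr p + l * (a + b) powr p"
      using 3 by (simp add: c_def d_def powr_divide)
    also have "\<dots> = (a + b) powr p" by (simp add: algebra_simps)
    finally show ?thesis
      using assms ab by (simp add: Lp_norm_le_iff a_def b_def)
  qed
qed

lemma Lp_norm_lincomb_le:
  assumes "1 < p" "f \<in> Lp_fun M p" "g \<in> Lp_fun M p"
  shows "Lp_norm M p (\<lambda>s. c *\<^sub>R f s + d *\<^sub>R g s) \<le> \<bar>c\<bar> * Lp_norm M p f + \<bar>d\<bar> * Lp_norm M p g"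
  using Lp_norm_triangle[OF assms(1) Lp_fun_scaleR[OF assms(2)] Lp_fun_scaleR[OF assms(3)], of c d]
  by (simp add: Lp_norm_scaleR[OF assms(1)])

lemma Lp_norm_add_scaleR_dist:
  assumes "1 < p" "f \<in> Lp_fun M p" "g \<in> Lp_fun M p"
  shows "\<bar>Lp_norm M p (\<lambda>s. f s + c *\<^sub>R g s) - Lp_norm M p f\<bar> \<le> \<bar>c\<bar> * Lp_norm M p g"
proof -
  have "(\<lambda>s. f s + c *\<^sub>R g s) \<in> Lp_fun M p"
    using assms by (intro Lp_fun_intros)
  from Lp_norm_lincomb_le[OF assms(1) this assms(3), of 1 "-c"] Lp_norm_lincomb_le[OF assms, of 1 c]
  show ?thesis by simp
qed

section \<open>Differentiability of the seminorm, uniformly over bounded directions\<close>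

lemma convex_on_Lp_norm_line:
  assumes "1 < p" "f \<in> Lp_fun M p" "v \<in> Lp_fun M p"
  shows "convex_on UNIV (\<lambda>t. Lp_norm M p (\<lambda>s. f s + t *\<^sub>R v s))"
proof (intro convex_onI)
  fix l x y :: real
  assume l: "0 < l" "l < 1"
  have "(\<lambda>s. f s + ((1 - l) *\<^sub>R x + l *\<^sub>R y) *\<^sub>R v s)
      = (\<lambda>s. (1 - l) *\<^sub>R (f s + x *\<^sub>R v s) + l *\<^sub>R (f s + y *\<^sub>R v s))"
    by (simp add: algebra_simps)
  moreover have "(\<lambda>s. f s + t *\<^sub>R v s) \<in> Lp_fun M p" for t
    using assms by (intro Lp_fun_intros)
  ultimately show "Lp_norm M p (\<lambda>s. f s + ((1 - l) *\<^sub>R x + l *\<^sub>R y) *\<^sub>R v s)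
      \<le> (1 - l) * Lp_norm M p (\<lambda>s. f s + x *\<^sub>R v s) + l * Lp_norm M p (\<lambda>s. f s + y *\<^sub>R v s)"
    using Lp_norm_lincomb_le[OF assms(1), of "\<lambda>s. f s + x *\<^sub>R v s" M "\<lambda>s. f s + y *\<^sub>R v s" "1 - l" l] l
    by simp
qed auto

text \<open>The integrated pointwise bound has a part linear in \<open>t\<close> with a small
  coefficient and a remainder of order \<open>t powr p\<close>. Since \<open>1 < p\<close>, the
  remainder is also small against \<open>t\<close>.\<close>

lemma Lp_norm_smooth:
  fixes f :: "'a \<Rightarrow> 'b::real_normed_vector"
  assumes "uniformly_smooth TYPE('b)" "1 < p" "f \<in> Lp_fun M p" "Lp_norm M p f > 0" "0 < e" "0 < R"
  shows "\<exists>\<delta>>0. \<forall>v\<in>Lp_fun M p. Lp_norm M p v \<le> R \<longrightarrow> (\<forall>t\<in>{0<..<\<delta>}.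
    Lp_norm M p (\<lambda>s. f s + t *\<^sub>R v s) + Lp_norm M p (\<lambda>s. f s - t *\<^sub>R v s) - 2 * Lp_norm M p f \<le> e * t)"
proof -
  define a where "a = Lp_norm M p f"
  define c where "c = p * a powr (p - 1)"
  define B where "B = a powr p + R powr p"
  \<comment> \<open>\<open>B\<close> bounds the sum of the p-th powers of the norms of
    \<open>f\<close> and \<open>v\<close>, so the linear part uses half of the allowance
    \<open>c * e\<close>.\<close>
  define e1 where "e1 = c * e / (2 * B)"
  have "0 < a" "0 < c" "0 < B"
    using assms by (auto simp: a_def c_def B_def add_pos_pos)
  then have pos: "0 < a" "0 < c" "0 < B" "0 < e1" and e1: "e1 * B = c * e / 2"
    using assms by (simp_all add: e1_def)
  obtain K where K: "K \<ge> 0" "\<And>(x::'b) y t. 0 < t \<Longrightarrow>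
      norm (x + t *\<^sub>R y) powr p + norm (x - t *\<^sub>R y) powr p - 2 * norm x powr p
        \<le> e1 * t * (norm x powr p + norm y powr p) + K * t powr p * norm y powr p"
    using powr_norm_smooth_bound[OF assms(1,2) pos(4)] by meson
  \<comment> \<open>The summand 1 keeps the divisor in \<open>m\<close> positive even if
    \<open>K = 0\<close>. The remainder uses the other half of \<open>c * e\<close> as soon as
    \<open>t powr (p - 1) \<le> m\<close>, which is what \<open>\<delta>\<close> ensures.\<close>
  define q where "q = K * R powr p + 1"
  define m where "m = c * e / 2 / q"
  have KR: "0 \<le> K * R powr p" using K by simp
  then have q: "0 < q" by (simp add: q_def)
  then have m: "0 < m" using pos assms by (simp add: m_def)
  have mK: "K * R powr p * m \<le> c * e / 2"
  proof -
    have "K * R powr p * m \<le> q * m" using m by (simp add: q_def)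
    also have "\<dots> = c * e / 2" using q by (simp add: m_def)
    finally show ?thesis .
  qed
  define \<delta> where "\<delta> = m powr (1 / (p - 1))"
  have \<delta>: "0 < \<delta>" "\<delta> powr (p - 1) = m" using m assms(2) by (auto simp: \<delta>_def powr_powr)
  have "Lp_norm M p (\<lambda>s. f s + t *\<^sub>R v s) + Lp_norm M p (\<lambda>s. f s - t *\<^sub>R v s) - 2 * Lp_norm M p f \<le> e * t"
    if v: "v \<in> Lp_fun M p" "Lp_norm M p v \<le> R" and t: "0 < t" "t < \<delta>" for v t
  proof -
    define F where "F = (\<lambda>h::'a \<Rightarrow> 'b. \<integral>s. norm (h s) powr p \<partial>M)"
    define N1 N2 where "N1 = Lp_norm M p (\<lambda>s. f s + t *\<^sub>R v s)" and "N2 = Lp_norm M p (\<lambda>s. f s - t *\<^sub>R v s)"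
    have mem: "(\<lambda>s. f s + t *\<^sub>R v s) \<in> Lp_fun M p" "(\<lambda>s. f s - t *\<^sub>R v s) \<in> Lp_fun M p"
      using assms v by (auto intro!: Lp_fun_intros)
    have Fv: "F v \<le> R powr p" using v assms by (simp add: F_def flip: Lp_norm_le_iff)
    have Ff: "F f = a powr p" using assms(2) by (simp add: F_def a_def Lp_norm_powr)
    have "N1 powr p + N2 powr p - 2 * a powr p
        = (\<integral>s. norm (f s + t *\<^sub>R v s) powr p + norm (f s - t *\<^sub>R v s) powr p - 2 * norm (f s) powr p \<partial>M)"
      using assms(2,3) mem by (simp add: N1_def N2_def a_def Lp_norm_powr Lp_fun_def)
    also have "\<dots> \<le> (\<integral>s. e1 * t * (norm (f s) powr p + norm (v s) powr p) + K * t powr p * norm (v s) powr p \<partial>M)"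
      using assms(2,3) mem v t K by (intro integral_mono) (auto simp: Lp_fun_def)
    also have "\<dots> = e1 * t * (F f + F v) + K * t powr p * F v"
      using assms(3) v by (simp add: Lp_fun_def F_def)
    also have "\<dots> \<le> e1 * t * B + K * t powr p * R powr p"
      using Fv Ff pos K t by (intro add_mono mult_left_mono) (auto simp: B_def)
    also have "\<dots> = (e1 * B) * t + (K * R powr p * t powr (p - 1)) * t"
    proof -
      have "t powr p = t * t powr (p - 1)" using t by (simp add: powr_mult_base)
      then show ?thesis by simp
    qed
    also have "\<dots> \<le> (c * e / 2) * t + (c * e / 2) * t"
    proof (intro add_mono mult_right_mono)
      have "t powr (p - 1) \<le> m"
        unfolding \<delta>(2)[symmetric] using t assms by (intro powr_mono2) auto
      then have "K * R powr p * t powr (p - 1) \<le> K * R powr p * m"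
        using KR by (intro mult_left_mono) auto
      then show "K * R powr p * t powr (p - 1) \<le> c * e / 2" using mK by linarith
    qed (use t e1 in auto)
    finally have upper: "N1 powr p + N2 powr p - 2 * a powr p \<le> c * (e * t)"
      by (simp add: algebra_simps)
    \<comment> \<open>Back from p-th powers to norms: the tangent at \<open>a\<close> has slope
      \<open>c > 0\<close>, so the upper bound on the sum of powers becomes a bound on
      \<open>N1 + N2 - 2 * a\<close> after division by \<open>c\<close>.\<close>
    have "a powr p + c * (N1 - a) \<le> N1 powr p" "a powr p + c * (N2 - a) \<le> N2 powr p"
      using powr_tangent_le[OF assms(2) pos(1)] by (auto simp: c_def N1_def N2_def)
    then have "c * (N1 + N2 - 2 * a) \<le> c * (e * t)"
      using upper by (simp add: algebra_simps)
    then show ?thesis using pos(2) by (simp add: N1_def N2_def a_def)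
  qed
  then show ?thesis using \<delta> by auto
qed

definition Lp_smoothness_fun :: "'a measure \<Rightarrow> real \<Rightarrow> ('a \<Rightarrow> 'b::real_normed_vector) \<Rightarrow> ('a \<Rightarrow> 'b) \<Rightarrow> real" where
  "Lp_smoothness_fun M p f v =
     Lim (at_right 0) (\<lambda>t. (Lp_norm M p (\<lambda>s. f s + t *\<^sub>R v s) - Lp_norm M p f) / t)"

lemma Lp_smoothness_fun_bounds:
  assumes "1 < p" "f \<in> Lp_fun M p" "v \<in> Lp_fun M p" "0 < t"
  shows "(Lp_norm M p f - Lp_norm M p (\<lambda>s. f s - t *\<^sub>R v s)) / t \<le> Lp_smoothness_fun M p f v"
    and "Lp_smoothness_fun M p f v \<le> (Lp_norm M p (\<lambda>s. f s + t *\<^sub>R v s) - Lp_norm M p f) / t"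
  using convex_right_derivative_bounds[OF convex_on_Lp_norm_line[OF assms(1-3)] assms(4)]
  by (simp_all add: Lp_smoothness_fun_def)

lemma abs_Lp_smoothness_fun_le:
  assumes "1 < p" "f \<in> Lp_fun M p" "v \<in> Lp_fun M p"
  shows "\<bar>Lp_smoothness_fun M p f v\<bar> \<le> Lp_norm M p v"
  using Lp_smoothness_fun_bounds[OF assms, of 1]
    Lp_norm_add_scaleR_dist[OF assms, of 1] Lp_norm_add_scaleR_dist[OF assms, of "-1"]
  by simp

text \<open>At \<open>t = 1\<close> the backward and the forward quotient both equal the norm of
  \<open>f\<close>, which pins the value between them.\<close>

lemma Lp_smoothness_fun_self:
  assumes "1 < p" "f \<in> Lp_fun M p"
  shows "Lp_smoothness_fun M p f f = Lp_norm M p f"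
proof -
  have "(\<lambda>s. f s + 1 *\<^sub>R f s) = (\<lambda>s. 2 *\<^sub>R f s)" by (simp add: scaleR_2)
  then show ?thesis
    using Lp_smoothness_fun_bounds[OF assms assms(2), of 1]
    by (simp add: Lp_norm_scaleR[OF assms(1)])
qed

text \<open>The derivative lies between the backward and the forward difference quotient. Their gap
  is the second difference divided by \<open>t\<close>, which is at most \<open>e\<close> uniformly
  over the ball of radius \<open>R\<close>.\<close>

lemma Lp_norm_frechet_smooth:
  fixes f :: "'a \<Rightarrow> 'b::real_normed_vector"
  assumes "uniformly_smooth TYPE('b)" "1 < p" "f \<in> Lp_fun M p" "Lp_norm M p f > 0" "0 < e" "0 < R"
  shows "\<exists>\<delta>>0. \<forall>v\<in>Lp_fun M p. Lp_norm M p v \<le> R \<longrightarrow> (\<forall>t\<in>{0<..<\<delta>}.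
    \<bar>(Lp_norm M p (\<lambda>s. f s + t *\<^sub>R v s) - Lp_norm M p f) / t - Lp_smoothness_fun M p f v\<bar> \<le> e)"
proof -
  obtain \<delta> where \<delta>: "\<delta> > 0" "\<forall>v\<in>Lp_fun M p. Lp_norm M p v \<le> R \<longrightarrow> (\<forall>t\<in>{0<..<\<delta>}.
    Lp_norm M p (\<lambda>s. f s + t *\<^sub>R v s) + Lp_norm M p (\<lambda>s. f s - t *\<^sub>R v s) - 2 * Lp_norm M p f \<le> e * t)"
    using Lp_norm_smooth[OF assms] by blast
  have "\<bar>(Lp_norm M p (\<lambda>s. f s + t *\<^sub>R v s) - Lp_norm M p f) / t - Lp_smoothness_fun M p f v\<bar> \<le> e"
    if v: "v \<in> Lp_fun M p" "Lp_norm M p v \<le> R" and t: "0 < t" "t < \<delta>" for v t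
  proof -
    define N1 N2 a where "N1 = Lp_norm M p (\<lambda>s. f s + t *\<^sub>R v s)"
      and "N2 = Lp_norm M p (\<lambda>s. f s - t *\<^sub>R v s)" and "a = Lp_norm M p f"
    have "(N1 - a) / t - (a - N2) / t = (N1 + N2 - 2 * a) / t"
      by (simp flip: diff_divide_distrib)
    also have "\<dots> \<le> e"
      using \<delta>(2)[rule_format, OF v, of t] t by (simp add: N1_def N2_def a_def pos_divide_le_eq)
    finally show ?thesis
      using Lp_smoothness_fun_bounds[OF assms(2,3) v(1) t(1)]
      unfolding N1_def N2_def a_def by linarith
  qed
  then show ?thesis using \<delta>(1) by auto
qed

section \<open>Strict convexity of the seminorm\<close>

text \<open>The pointwise convexity defect \<open>d\<close> is nonnegative, and the three norm
  bounds force its integral to be at most 0. So \<open>d\<close> vanishes almost everywhere, and the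
  pointwise equality case applies.\<close>

lemma Lp_midpoint_unique:
  fixes u w :: "'a \<Rightarrow> 'b::real_normed_vector"
  assumes "uniformly_convex TYPE('b)" "1 < p" "u \<in> Lp_fun M p" "w \<in> Lp_fun M p"
    and "Lp_norm M p u \<le> m" "Lp_norm M p w \<le> m" "m \<le> Lp_norm M p (\<lambda>s. (1/2) *\<^sub>R (u s + w s))"
  shows "AE s in M. u s = w s"
proof -
  define d where "d = (\<lambda>s. (norm (u s) powr p + norm (w s) powr p) / 2 - norm ((1/2) *\<^sub>R (u s + w s)) powr p)"
  have m: "0 \<le> m" using assms(5) Lp_norm_nonneg[of M p u] by linarith
  have mid: "(\<lambda>s. (1/2) *\<^sub>R (u s + w s)) \<in> Lp_fun M p"
    using assms(2-4) by (intro Lp_fun_intros)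
  have int: "integrable M (\<lambda>s. norm (u s) powr p)" "integrable M (\<lambda>s. norm (w s) powr p)"
    "integrable M (\<lambda>s. norm ((1/2) *\<^sub>R (u s + w s)) powr p)"
    using assms(3,4) mid Lp_funD(2) by blast+
  have d_nonneg: "0 \<le> d s" for s
    using norm_midpoint_powr_le[OF assms(2), of "u s" "w s"] by (simp only: d_def diff_ge_0_iff_ge)
  have d_int: "integrable M d"
    unfolding d_def using int by (intro Bochner_Integration.integrable_diff Bochner_Integration.integrable_add integrable_divide_zero) auto
  define N where "N = Lp_norm M p (\<lambda>s. (1/2) *\<^sub>R (u s + w s))"
  have "(\<integral>s. d s \<partial>M) = (Lp_norm M p u powr p + Lp_norm M p w powr p) / 2 - N powr p"
    unfolding d_def N_def Lp_norm_powr[OF assms(2)] using int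
    by (subst Bochner_Integration.integral_diff) (auto intro!: Bochner_Integration.integrable_add simp del: norm_scaleR)
  moreover have "Lp_norm M p u powr p \<le> m powr p" "Lp_norm M p w powr p \<le> m powr p"
    "m powr p \<le> N powr p"
    using assms(2,5,6) assms(7)[folded N_def] m by (auto intro!: powr_mono2)
  ultimately have "(\<integral>s. d s \<partial>M) \<le> (m powr p + m powr p) / 2 - m powr p"
    by (simp only:) (intro diff_mono divide_right_mono add_mono, auto)
  then have "(\<integral>s. d s \<partial>M) \<le> 0" by simp
  moreover have "0 \<le> (\<integral>s. d s \<partial>M)"
    using d_nonneg by simp
  ultimately have "(\<integral>s. d s \<partial>M) = 0" by linarith
  then have "AE s in M. d s = 0"
    using integral_nonneg_eq_0_iff_AE[OF d_int] d_nonneg by simp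
  then show ?thesis
  proof eventually_elim
    case (elim s)
    then show ?case
      using norm_midpoint_powr_eqD[OF assms(1,2), of "u s" "w s"] unfolding d_def by linarith
  qed
qed

section \<open>The projection onto the cylinder\<close>

abbreviation restr :: "'a set \<Rightarrow> ('a \<Rightarrow> 'b::zero) \<Rightarrow> 'a \<Rightarrow> 'b" where
  "restr E f \<equiv> (\<lambda>s. if s \<in> E then f s else 0)"

lemma Lp_fun_restr: "f \<in> Lp_fun M p \<Longrightarrow> E \<in> sets M \<Longrightarrow> restr E f \<in> Lp_fun M p"
  by (intro Lp_fun_intros)

lemma Lp_norm_restr_le:
  assumes "1 < p" "f \<in> Lp_fun M p" "E \<in> sets M"
  shows "Lp_norm M p (restr E f) \<le> Lp_norm M p f"
  using assms by (intro Lp_norm_mono Lp_fun_restr) auto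

definition cyl_proj :: "'a measure \<Rightarrow> real \<Rightarrow> 'a set \<Rightarrow> real \<Rightarrow> ('a \<Rightarrow> 'b::real_normed_vector) \<Rightarrow> 'a \<Rightarrow> 'b" where
  "cyl_proj M p A r f =
     (if Lp_norm M p (restr A f) \<le> r then f
      else (\<lambda>s. if s \<in> A then (r / Lp_norm M p (restr A f)) *\<^sub>R f s else f s))"

lemma cyl_proj_in_Lp_fun:
  assumes "f \<in> Lp_fun M p" "A \<in> sets M"
  shows "cyl_proj M p A r f \<in> Lp_fun M p"
  using assms by (auto simp: cyl_proj_def intro!: Lp_fun_intros)

lemma cyl_proj_in_cyl:
  assumes "1 < p" "0 < r"
  shows "Lp_norm M p (restr A (cyl_proj M p A r f)) \<le> r"
proof (cases "Lp_norm M p (restr A f) \<le> r")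
  case False
  have "restr A (cyl_proj M p A r f) = (\<lambda>s. (r / Lp_norm M p (restr A f)) *\<^sub>R restr A f s)"
    using False by (auto simp: cyl_proj_def)
  then show ?thesis
    using False assms by (simp add: Lp_norm_scaleR)
next
  case True
  then have "cyl_proj M p A r f = f" by (simp add: cyl_proj_def)
  with True show ?thesis by metis
qed

text \<open>Outside the cylinder the displacement is \<open>1 - r / a\<close> times the restriction
  of \<open>f\<close>, so the distance is exactly \<open>a - r\<close>. No point \<open>z\<close> of
  the cylinder is closer, by the triangle inequality on \<open>A\<close>. Inside, the distance is
  0.\<close>

lemma cyl_proj_minimal:
  assumes "1 < p" "0 < r" "f \<in> Lp_fun M p" "z \<in> Lp_fun M p" "A \<in> sets M"
    and "Lp_norm M p (restr A z) \<le> r"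
  shows "Lp_norm M p (\<lambda>s. f s - cyl_proj M p A r f s) \<le> Lp_norm M p (\<lambda>s. f s - z s)"
proof (cases "Lp_norm M p (restr A f) \<le> r")
  case False
  define a where "a = Lp_norm M p (restr A f)"
  have a: "r < a" using False by (simp add: a_def)
  have fz: "(\<lambda>s. f s - z s) \<in> Lp_fun M p" using assms by (intro Lp_fun_intros)
  have "(\<lambda>s. f s - cyl_proj M p A r f s) = (\<lambda>s. (1 - r / a) *\<^sub>R restr A f s)"
    using False by (auto simp: cyl_proj_def a_def algebra_simps)
  then have "Lp_norm M p (\<lambda>s. f s - cyl_proj M p A r f s) = \<bar>1 - r / a\<bar> * a"
    by (simp only: Lp_norm_scaleR[OF assms(1)] a_def)
  also have "\<dots> = a - r"
    using a assms by (simp add: field_simps)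
  also have "a \<le> Lp_norm M p (restr A z) + Lp_norm M p (restr A (\<lambda>s. f s - z s))"
  proof -
    have "restr A f = (\<lambda>s. restr A z s + restr A (\<lambda>s. f s - z s) s)" by auto
    then show ?thesis
      using Lp_norm_triangle[OF assms(1), of "restr A z" M "restr A (\<lambda>s. f s - z s)"]
        Lp_fun_restr[OF fz assms(5)] Lp_fun_restr[OF assms(4,5)] by (simp only: a_def)
  qed
  also have "\<dots> - r \<le> Lp_norm M p (\<lambda>s. f s - z s)"
    using assms(6) Lp_norm_restr_le[OF assms(1) fz assms(5)] by linarith
  finally show ?thesis by simp
qed (simp add: cyl_proj_def)

text \<open>The midpoint of two nearest points lies in the cylinder by convexity, so it is no closer
  to \<open>f\<close>. Then \<open>f - y\<close> and \<open>f - z\<close> satisfy the hypotheses of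
  \<open>Lp_midpoint_unique\<close>, with \<open>m\<close> the least distance.\<close>

lemma cyl_projection_unique:
  fixes f :: "'a \<Rightarrow> 'b::real_normed_vector"
  assumes "uniformly_convex TYPE('b)" "1 < p"
    and "f \<in> Lp_fun M p" "y \<in> Lp_fun M p" "z \<in> Lp_fun M p" "A \<in> sets M"
    and y: "Lp_norm M p (restr A y) \<le> r"
      "\<And>x. x \<in> Lp_fun M p \<Longrightarrow> Lp_norm M p (restr A x) \<le> r \<Longrightarrow>
        Lp_norm M p (\<lambda>s. f s - y s) \<le> Lp_norm M p (\<lambda>s. f s - x s)"
    and z: "Lp_norm M p (restr A z) \<le> r" "Lp_norm M p (\<lambda>s. f s - z s) \<le> Lp_norm M p (\<lambda>s. f s - y s)"
  shows "AE s in M. y s = z s"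
proof -
  define x where "x = (\<lambda>s. (1/2) *\<^sub>R (y s + z s))"
  have x: "x \<in> Lp_fun M p" unfolding x_def using assms(2-5) by (intro Lp_fun_intros)
  have "restr A x = (\<lambda>s. (1/2) *\<^sub>R restr A y s + (1/2) *\<^sub>R restr A z s)"
    by (auto simp: x_def scaleR_add_right)
  then have "Lp_norm M p (restr A x) \<le> r"
    using Lp_norm_lincomb_le[OF assms(2) Lp_fun_restr[OF assms(4,6)] Lp_fun_restr[OF assms(5,6)], of "1/2" "1/2"]
      y(1) z(1) by simp
  from y(2)[OF x this]
  have "Lp_norm M p (\<lambda>s. f s - y s) \<le> Lp_norm M p (\<lambda>s. f s - x s)" .
  also have "(\<lambda>s. f s - x s) = (\<lambda>s. (1/2) *\<^sub>R ((f s - y s) + (f s - z s)))"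
  proof
    fix s
    have "f s = (1/2) *\<^sub>R (f s + f s)" by (simp flip: scaleR_2)
    then have "f s - x s = (1/2) *\<^sub>R (f s + f s) - (1/2) *\<^sub>R (y s + z s)" by (simp only: x_def)
    then show "f s - x s = (1/2) *\<^sub>R ((f s - y s) + (f s - z s))"
      by (simp only: scaleR_diff_right[symmetric] add_diff_add[symmetric])
  qed
  finally have "AE s in M. f s - y s = f s - z s"
    using assms(1-5) z(2)
    by (intro Lp_midpoint_unique[where m = "Lp_norm M p (\<lambda>s. f s - y s)"]) (auto intro!: Lp_fun_diff)
  then show ?thesis by simp
qed

section \<open>Difference quotients of the explicit projection\<close>

text \<open>On \<open>A\<close> this is the quotient rule for \<open>f\<close> divided by its norm
  on \<open>A\<close>, times \<open>r\<close>; the smoothness function stands for the derivative of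
  that norm.\<close>

definition cyl_proj_deriv :: "'a measure \<Rightarrow> real \<Rightarrow> 'a set \<Rightarrow> real \<Rightarrow> ('a \<Rightarrow> 'b::real_normed_vector) \<Rightarrow> ('a \<Rightarrow> 'b) \<Rightarrow> 'a \<Rightarrow> 'b" where
  "cyl_proj_deriv M p A r f v = (\<lambda>s. if s \<in> A
     then (r / Lp_norm M p (restr A f)) *\<^sub>R
       (v s - (Lp_smoothness_fun M p (restr A f) (restr A v) / Lp_norm M p (restr A f)) *\<^sub>R f s)
     else v s)"

lemma cyl_proj_deriv_in_Lp_fun:
  assumes "1 < p" "f \<in> Lp_fun M p" "v \<in> Lp_fun M p" "A \<in> sets M"
  shows "cyl_proj_deriv M p A r f v \<in> Lp_fun M p"
  unfolding cyl_proj_deriv_def using assms by (intro Lp_fun_intros)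

text \<open>Steps shorter than the gap to \<open>r\<close> divided by \<open>R\<close> stay in the
  cylinder, where the projection is the identity, so the quotient is exact and not merely
  close.\<close>

lemma cyl_proj_inner_diff_quot:
  fixes f :: "'a \<Rightarrow> 'b::real_normed_vector"
  assumes "1 < p" "f \<in> Lp_fun M p" "A \<in> sets M" "Lp_norm M p (restr A f) < r" "0 < R"
  shows "\<exists>\<delta>>0. \<forall>v\<in>Lp_fun M p. Lp_norm M p v \<le> R \<longrightarrow> (\<forall>t\<in>{0<..<\<delta>}.
    (\<lambda>s. (1 / t) *\<^sub>R (cyl_proj M p A r (\<lambda>s. f s + t *\<^sub>R v s) s - cyl_proj M p A r f s)) = v)"
proof (intro exI[of _ "(r - Lp_norm M p (restr A f)) / R"] conjI ballI impI)
  fix v :: "'a \<Rightarrow> 'b" and t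
  assume v: "v \<in> Lp_fun M p" "Lp_norm M p v \<le> R"
    and t: "t \<in> {0<..<(r - Lp_norm M p (restr A f)) / R}"
  have "restr A (\<lambda>s. f s + t *\<^sub>R v s) = (\<lambda>s. restr A f s + t *\<^sub>R restr A v s)" by auto
  then have "Lp_norm M p (restr A (\<lambda>s. f s + t *\<^sub>R v s)) \<le> Lp_norm M p (restr A f) + t * Lp_norm M p (restr A v)"
    using Lp_norm_add_scaleR_dist[OF assms(1) Lp_fun_restr[OF assms(2,3)] Lp_fun_restr[OF v(1) assms(3)], of t] t
    by simp
  also have "t * Lp_norm M p (restr A v) \<le> t * R"
    using Lp_norm_restr_le[OF assms(1) v(1) assms(3)] v t by (intro mult_left_mono) auto
  also have "t * R \<le> r - Lp_norm M p (restr A f)"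
    using t assms(5) by (simp add: pos_less_divide_eq)
  finally have "Lp_norm M p (restr A (\<lambda>s. f s + t *\<^sub>R v s)) \<le> r" by simp
  then show "(\<lambda>s. (1 / t) *\<^sub>R (cyl_proj M p A r (\<lambda>s. f s + t *\<^sub>R v s) s - cyl_proj M p A r f s)) = v"
    using assms(4) t by (simp add: cyl_proj_def)
qed (use assms in auto)

text \<open>First-order expansion of \<open>r / b\<close> around \<open>a\<close>, with
  \<open>\<psi>\<close> as approximate rate of change from \<open>a\<close> to \<open>b\<close>. The
  weights \<open>a\<close> and \<open>R\<close> are the norm of \<open>f\<close> on \<open>A\<close>
  and a bound for the norm of \<open>v\<close> on \<open>A\<close>, by which the two coefficients
  get multiplied later.\<close>

lemma inverse_diff_quot_bound:
  fixes a b r t e R \<psi> :: real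
  assumes "0 < r" "r < a" "r < b" "0 < t" "\<bar>\<psi>\<bar> \<le> R" "\<bar>b - a\<bar> \<le> t * R" "\<bar>(b - a) / t - \<psi>\<bar> \<le> e"
  shows "\<bar>(r / b - r / a) / t + r * \<psi> / a\<^sup>2\<bar> * a + \<bar>r / b - r / a\<bar> * R \<le> 2 * t * R\<^sup>2 / a + e"
proof -
  have R: "0 \<le> R" using assms(5) by linarith
  define q where "q = (b - a) / t"
  have ba: "b - a = t * q" using assms by (simp add: q_def)
  \<comment> \<open>The numerator splits into a term of order \<open>t\<close>, from
    \<open>b - a\<close>, and the differentiability error \<open>\<psi> - q\<close>.\<close>
  have "(r / b - r / a) / t + r * \<psi> / a\<^sup>2 = r * (\<psi> * (b - a) + a * (\<psi> - q)) / (a\<^sup>2 * b)"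
    using assms by (simp add: q_def field_simps power2_eq_square)
  then have "\<bar>(r / b - r / a) / t + r * \<psi> / a\<^sup>2\<bar> * a = \<bar>\<psi> * (b - a) + a * (\<psi> - q)\<bar> / a * (r / b)"
    using assms by (simp add: abs_mult abs_divide power2_eq_square)
  \<comment> \<open>The factor \<open>r / b\<close> is at most 1 because \<open>b\<close> stays
    above \<open>r\<close>.\<close>
  also have "\<dots> \<le> \<bar>\<psi> * (b - a) + a * (\<psi> - q)\<bar> / a * 1"
    using assms by (intro mult_left_mono) auto
  also have "\<dots> \<le> (R * (t * R) + a * e) / a * 1"
  proof (intro mult_right_mono divide_right_mono)
    have "\<bar>\<psi> * (b - a) + a * (\<psi> - q)\<bar> \<le> \<bar>\<psi>\<bar> * \<bar>b - a\<bar> + \<bar>a\<bar> * \<bar>\<psi> - q\<bar>"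
      by (metis abs_mult abs_triangle_ineq)
    also have "\<dots> \<le> R * (t * R) + a * e"
      using assms R by (intro add_mono mult_mono) (auto simp: q_def abs_minus_commute)
    finally show "\<bar>\<psi> * (b - a) + a * (\<psi> - q)\<bar> \<le> R * (t * R) + a * e" .
  qed (use assms in auto)
  also have "\<dots> = t * R\<^sup>2 / a + e"
    using assms by (simp add: field_simps power2_eq_square)
  finally have 1: "\<bar>(r / b - r / a) / t + r * \<psi> / a\<^sup>2\<bar> * a \<le> t * R\<^sup>2 / a + e" .
  have "r / b - r / a = (a - b) / a * (r / b)"
    using assms by (simp add: field_simps)
  then have "\<bar>r / b - r / a\<bar> = \<bar>b - a\<bar> / a * (r / b)"
    using assms by (simp add: abs_mult abs_divide abs_minus_commute)
  also have "\<dots> \<le> (t * R) / a * 1"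
    using assms R by (intro mult_mono divide_right_mono) auto
  finally have "\<bar>r / b - r / a\<bar> * R \<le> (t * R) / a * R"
    using R by (intro mult_right_mono) auto
  also have "\<dots> = t * R\<^sup>2 / a" by (simp add: power2_eq_square)
  finally have "\<bar>r / b - r / a\<bar> * R \<le> t * R\<^sup>2 / a" .
  from add_mono[OF 1 this] show ?thesis by simp
qed

text \<open>The error is a combination \<open>k *\<^sub>R f + l *\<^sub>R v\<close> on
  \<open>A\<close> and 0 off \<open>A\<close>. Its norm is therefore governed by two real
  coefficients, which depend on \<open>v\<close> only through the norm and its derivative.\<close>

lemma cyl_proj_outer_diff_quot:
  fixes f :: "'a \<Rightarrow> 'b::real_normed_vector"
  assumes "uniformly_smooth TYPE('b)" "1 < p" "f \<in> Lp_fun M p" "A \<in> sets M" "0 < r"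
    and "r < Lp_norm M p (restr A f)" "0 < R" "0 < e"
  shows "\<exists>\<delta>>0. \<forall>v\<in>Lp_fun M p. Lp_norm M p v \<le> R \<longrightarrow> (\<forall>t\<in>{0<..<\<delta>}.
    Lp_norm M p (\<lambda>s. (1 / t) *\<^sub>R (cyl_proj M p A r (\<lambda>s. f s + t *\<^sub>R v s) s - cyl_proj M p A r f s)
      - cyl_proj_deriv M p A r f v s) < e)"
proof -
  define a where "a = Lp_norm M p (restr A f)"
  have a: "0 < a" "r < a" using assms by (auto simp: a_def)
  note fA = Lp_fun_restr[OF assms(3,4)]
  obtain \<delta>1 where \<delta>1: "0 < \<delta>1" "\<forall>v\<in>Lp_fun M p. Lp_norm M p v \<le> R \<longrightarrow> (\<forall>t\<in>{0<..<\<delta>1}.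
    \<bar>(Lp_norm M p (\<lambda>s. restr A f s + t *\<^sub>R v s) - a) / t - Lp_smoothness_fun M p (restr A f) v\<bar> \<le> e / 4)"
    using Lp_norm_frechet_smooth[OF assms(1,2) fA, of "e/4" R] assms a unfolding a_def by auto
  \<comment> \<open>Three constraints: differentiability of the norm up to \<open>e / 4\<close>, the
    perturbed point staying outside the cylinder, and the second-order term
    \<open>2 * t * R\<^sup>2 / a\<close> staying below \<open>e / 2\<close>.\<close>
  define \<delta> where "\<delta> = min \<delta>1 (min ((a - r) / R) (e * a / (4 * R\<^sup>2)))"
  have \<delta>: "0 < \<delta>" using \<delta>1 a assms by (simp add: \<delta>_def)
  have "Lp_norm M p (\<lambda>s. (1 / t) *\<^sub>R (cyl_proj M p A r (\<lambda>s. f s + t *\<^sub>R v s) s - cyl_proj M p A r f s)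
      - cyl_proj_deriv M p A r f v s) < e"
    if v: "v \<in> Lp_fun M p" "Lp_norm M p v \<le> R" and t: "t \<in> {0<..<\<delta>}" for v t
  proof -
    define b where "b = Lp_norm M p (restr A (\<lambda>s. f s + t *\<^sub>R v s))"
    define \<psi> where "\<psi> = Lp_smoothness_fun M p (restr A f) (restr A v)"
    have t': "0 < t" "t < \<delta>1" "t * R < a - r" "2 * t * R\<^sup>2 / a < e / 2"
      using t a assms by (auto simp: \<delta>_def field_simps)
    note vA = Lp_fun_restr[OF v(1) assms(4)]
    have vA_le: "Lp_norm M p (restr A v) \<le> R"
      using Lp_norm_restr_le[OF assms(2) v(1) assms(4)] v by linarith
    have b_eq: "b = Lp_norm M p (\<lambda>s. restr A f s + t *\<^sub>R restr A v s)"
      unfolding b_def by (rule arg_cong[of _ _ "Lp_norm M p"]) auto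
    have "\<bar>b - a\<bar> \<le> t * Lp_norm M p (restr A v)"
      using Lp_norm_add_scaleR_dist[OF assms(2) fA vA, of t] t' unfolding b_eq a_def by simp
    also have "\<dots> \<le> t * R" using vA_le t' by simp
    finally have ba: "\<bar>b - a\<bar> \<le> t * R" .
    have b: "r < b" using ba t' by linarith
    have \<psi>: "\<bar>\<psi>\<bar> \<le> R"
      using abs_Lp_smoothness_fun_le[OF assms(2) fA vA] vA_le by (simp add: \<psi>_def)
    have quot: "\<bar>(b - a) / t - \<psi>\<bar> \<le> e / 4"
      unfolding b_eq \<psi>_def using \<delta>1(2)[rule_format, OF vA vA_le, of t] t' by simp
    \<comment> \<open>The coefficients of \<open>f\<close> and of \<open>v\<close> left over when
      the candidate derivative is subtracted from the quotient.\<close>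
    define k l where "k = (r / b - r / a) / t + r * \<psi> / a\<^sup>2" and "l = r / b - r / a"
    have "(\<lambda>s. (1 / t) *\<^sub>R (cyl_proj M p A r (\<lambda>s. f s + t *\<^sub>R v s) s - cyl_proj M p A r f s)
        - cyl_proj_deriv M p A r f v s) = (\<lambda>s. k *\<^sub>R restr A f s + l *\<^sub>R restr A v s)"
    proof
      fix s
      show "(1 / t) *\<^sub>R (cyl_proj M p A r (\<lambda>s. f s + t *\<^sub>R v s) s - cyl_proj M p A r f s)
        - cyl_proj_deriv M p A r f v s = k *\<^sub>R restr A f s + l *\<^sub>R restr A v s"
      proof (cases "s \<in> A")
        case True
        have "(1 / t) *\<^sub>R ((r / b) *\<^sub>R (x + t *\<^sub>R y) - (r / a) *\<^sub>R x) - (r / a) *\<^sub>R (y - (\<psi> / a) *\<^sub>R x)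
            = k *\<^sub>R x + l *\<^sub>R y" for x y :: 'b
        proof -
          have "(1 / t) *\<^sub>R ((r / b) *\<^sub>R (x + t *\<^sub>R y) - (r / a) *\<^sub>R x) - (r / a) *\<^sub>R (y - (\<psi> / a) *\<^sub>R x)
            = ((1 / t) * (r / b) - (1 / t) * (r / a) + (r / a) * (\<psi> / a)) *\<^sub>R x
              + ((1 / t) * (r / b) * t - r / a) *\<^sub>R y"
            by (simp only: scaleR_add_right scaleR_diff_right scaleR_scaleR scaleR_add_left scaleR_diff_left mult.assoc) simp
          also have "(1 / t) * (r / b) - (1 / t) * (r / a) + (r / a) * (\<psi> / a) = k"
            by (simp add: k_def diff_divide_distrib power2_eq_square mult.commute)
          also have "(1 / t) * (r / b) * t - r / a = l"
            using t' by (simp add: l_def)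
          finally show ?thesis .
        qed
        from this[of "f s" "v s"] show ?thesis
          using True a b assms(5)
          by (simp add: cyl_proj_def cyl_proj_deriv_def flip: a_def b_def \<psi>_def)
      next
        case False
        then show ?thesis
          using a b t' by (simp add: cyl_proj_def cyl_proj_deriv_def)
      qed
    qed
    then have "Lp_norm M p (\<lambda>s. (1 / t) *\<^sub>R (cyl_proj M p A r (\<lambda>s. f s + t *\<^sub>R v s) s - cyl_proj M p A r f s)
        - cyl_proj_deriv M p A r f v s) \<le> \<bar>k\<bar> * a + \<bar>l\<bar> * Lp_norm M p (restr A v)"
      using Lp_norm_lincomb_le[OF assms(2) fA vA, of k l] by (simp add: a_def)
    also have "\<dots> \<le> \<bar>k\<bar> * a + \<bar>l\<bar> * R"
      using vA_le by (intro add_left_mono mult_left_mono) auto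
    also have "\<dots> \<le> 2 * t * R\<^sup>2 / a + e / 4"
      unfolding k_def l_def using inverse_diff_quot_bound[OF assms(5) a(2) b t'(1) \<psi> ba quot] .
    also have "\<dots> < e" using t'(4) assms(8) by linarith
    finally show ?thesis .
  qed
  then show ?thesis using \<delta> by blast
qed

section \<open>Equivalence classes\<close>

lemma equiv_Lp_rel:
  "equiv (Lp_fun M p :: ('a \<Rightarrow> 'b::real_normed_vector) set) (Lp_rel M p)" (is "equiv ?F ?R")
proof (rule equivI)
  show "?R \<subseteq> ?F \<times> ?F" by (auto simp: Lp_rel_def)
  show "refl_on ?F ?R" by (auto simp: refl_on_def Lp_rel_def)
  show "sym ?R" by (auto simp: sym_def Lp_rel_def)
  show "trans ?R"
  proof (rule transI)
    fix f g h :: "'a \<Rightarrow> 'b"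
    assume fg: "(f, g) \<in> Lp_rel M p" and gh: "(g, h) \<in> Lp_rel M p"
    then have "AE s in M. f s = g s" "AE s in M. g s = h s" by (auto simp: Lp_rel_def)
    then have "AE s in M. f s = h s" by eventually_elim simp
    with fg gh show "(f, h) \<in> Lp_rel M p" by (auto simp: Lp_rel_def)
  qed
qed

lemma points_Lp: "points (Lp M p) = Lp_class M p ` Lp_fun M p"
  by (auto simp: Lp_def Lp_class_def quotient_def)

lemma Lp_class_eq_iff:
  assumes "f \<in> Lp_fun M p" "g \<in> Lp_fun M p"
  shows "Lp_class M p f = Lp_class M p g \<longleftrightarrow> (AE s in M. f s = g s)"
  unfolding Lp_class_def eq_equiv_class_iff[OF equiv_Lp_rel assms] using assms by (auto simp: Lp_rel_def)

text \<open>\<open>Lp_rep\<close> is an arbitrary choice, so agreement almost everywhere is all that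
  is known of it. That suffices to replace it by the given function in every operation of
  \<open>Lp\<close>.\<close>

lemma Lp_rep_class:
  assumes "f \<in> Lp_fun M p"
  shows "Lp_rep (Lp_class M p f) \<in> Lp_fun M p" "AE s in M. Lp_rep (Lp_class M p f) s = f s"
proof -
  have "f \<in> Lp_class M p f" using assms by (auto simp: Lp_class_def Lp_rel_def)
  then have "Lp_rep (Lp_class M p f) \<in> Lp_class M p f" unfolding Lp_rep_def by (rule someI[where P = "\<lambda>h. h \<in> Lp_class M p f"])
  then have "(f, Lp_rep (Lp_class M p f)) \<in> Lp_rel M p" by (simp add: Lp_class_def)
  then show "Lp_rep (Lp_class M p f) \<in> Lp_fun M p" "AE s in M. Lp_rep (Lp_class M p f) s = f s"
    by (auto simp: Lp_rel_def elim: AE_mp)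
qed

lemma nnorm_Lp_class:
  assumes "f \<in> Lp_fun M p"
  shows "nnorm (Lp M p) (Lp_class M p f) = Lp_norm M p f"
  using Lp_norm_cong_AE[OF Lp_rep_class(1)[OF assms] assms Lp_rep_class(2)[OF assms]]
  by (simp add: Lp_def Lp_norm_def)

lemma nnorm_Lp_on: "nnorm (Lp_on M p A) = nnorm (Lp M p)"
  by (simp add: Lp_on_def)

lemma nadd_Lp_class:
  assumes "1 < p" "f \<in> Lp_fun M p" "g \<in> Lp_fun M p"
  shows "Lp_class M p f \<boxplus>\<^bsub>Lp M p\<^esub> Lp_class M p g = Lp_class M p (\<lambda>s. f s + g s)"
proof -
  have "AE s in M. Lp_rep (Lp_class M p f) s + Lp_rep (Lp_class M p g) s = f s + g s"
    using Lp_rep_class(2)[OF assms(2)] Lp_rep_class(2)[OF assms(3)] by eventually_elim simp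
  then show ?thesis
    using assms by (simp add: Lp_def Lp_class_eq_iff Lp_fun_add Lp_rep_class(1))
qed

lemma nscale_Lp_class:
  assumes "f \<in> Lp_fun M p"
  shows "c \<odot>\<^bsub>Lp M p\<^esub> Lp_class M p f = Lp_class M p (\<lambda>s. c *\<^sub>R f s)"
proof -
  have "AE s in M. c *\<^sub>R Lp_rep (Lp_class M p f) s = c *\<^sub>R f s"
    using Lp_rep_class(2)[OF assms] by eventually_elim simp
  then show ?thesis
    using assms by (simp add: Lp_def Lp_class_eq_iff Lp_fun_scaleR Lp_rep_class(1))
qed

lemma nminus_Lp_class:
  assumes "1 < p" "f \<in> Lp_fun M p" "g \<in> Lp_fun M p"
  shows "Lp_class M p f \<boxminus>\<^bsub>Lp M p\<^esub> Lp_class M p g = Lp_class M p (\<lambda>s. f s - g s)"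
  using nadd_Lp_class[OF assms(1,2) Lp_fun_scaleR[OF assms(3)], of "-1"]
  by (simp add: nminus_def nscale_Lp_class[OF assms(3)])

lemma Lp_restrict_class:
  assumes "f \<in> Lp_fun M p" "E \<in> sets M"
  shows "Lp_restrict M p E (Lp_class M p f) = Lp_class M p (restr E f)"
proof -
  have "AE s in M. restr E (Lp_rep (Lp_class M p f)) s = restr E f s"
    using Lp_rep_class(2)[OF assms(1)] by eventually_elim simp
  then show ?thesis
    using assms by (simp add: Lp_restrict_def Lp_class_eq_iff Lp_fun_restr Lp_rep_class(1))
qed

lemma smoothness_fun_Lp_class:
  assumes "1 < p" "f \<in> Lp_fun M p" "v \<in> Lp_fun M p"
  shows "smoothness_fun (Lp M p) (Lp_class M p f) (Lp_class M p v) = Lp_smoothness_fun M p f v"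
  using assms
  by (simp add: smoothness_fun_def Lp_smoothness_fun_def nadd_Lp_class nscale_Lp_class nnorm_Lp_class
      Lp_fun_add Lp_fun_scaleR)

lemma Lp_class_in_Lp_cyl_iff:
  assumes "f \<in> Lp_fun M p" "A \<in> sets M"
  shows "Lp_class M p f \<in> Lp_cyl M p A r \<longleftrightarrow> Lp_norm M p (restr A f) \<le> r"
  using assms
  by (simp add: Lp_cyl_def points_Lp nnorm_Lp_on Lp_restrict_class nnorm_Lp_class Lp_fun_restr)

lemma Lp_class_in_Lp_open_cyl_iff:
  assumes "f \<in> Lp_fun M p" "A \<in> sets M"
  shows "Lp_class M p f \<in> Lp_open_cyl M p A r \<longleftrightarrow> Lp_norm M p (restr A f) < r"
  using assms
  by (simp add: Lp_open_cyl_def points_Lp nnorm_Lp_on Lp_restrict_class nnorm_Lp_class Lp_fun_restr)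

section \<open>The metric projection on classes\<close>

text \<open>The description operator asks for a unique minimiser; uniqueness almost everywhere
  becomes equality once classes are taken.\<close>

lemma metric_proj_Lp_cyl:
  fixes f :: "'a \<Rightarrow> 'b::real_normed_vector"
  assumes "uniformly_convex TYPE('b)" "1 < p" "0 < r" "A \<in> sets M" "f \<in> Lp_fun M p"
  shows "metric_proj (Lp M p) (Lp_cyl M p A r) (Lp_class M p f) = Lp_class M p (cyl_proj M p A r f)"
  unfolding metric_proj_def
proof (rule the_equality)
  let ?y = "cyl_proj M p A r f"
  note y = cyl_proj_in_Lp_fun[OF assms(5,4), of r]
  note y_cyl = cyl_proj_in_cyl[OF assms(2,3), of M A f]
  have cyl: "\<exists>z. Z = Lp_class M p z \<and> z \<in> Lp_fun M p \<and> Lp_norm M p (restr A z) \<le> r"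
    if "Z \<in> Lp_cyl M p A r" for Z :: "('a \<Rightarrow> 'b) set"
  proof -
    have "Z \<in> points (Lp M p)" using that by (simp add: Lp_cyl_def)
    then show ?thesis using that assms(4) by (auto simp: points_Lp Lp_class_in_Lp_cyl_iff)
  qed
  have dist: "nnorm (Lp M p) (Lp_class M p f \<boxminus>\<^bsub>Lp M p\<^esub> Lp_class M p z) = Lp_norm M p (\<lambda>s. f s - z s)"
    if "z \<in> Lp_fun M p" for z
    using assms that by (simp add: nminus_Lp_class nnorm_Lp_class Lp_fun_diff)
  show "Lp_class M p ?y \<in> Lp_cyl M p A r \<and> (\<forall>Z\<in>Lp_cyl M p A r.
      nnorm (Lp M p) (Lp_class M p f \<boxminus>\<^bsub>Lp M p\<^esub> Lp_class M p ?y) \<le> nnorm (Lp M p) (Lp_class M p f \<boxminus>\<^bsub>Lp M p\<^esub> Z))"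
  proof (intro conjI ballI)
    show "Lp_class M p ?y \<in> Lp_cyl M p A r"
      using Lp_class_in_Lp_cyl_iff[OF y assms(4)] y_cyl by blast
    fix Z :: "('a \<Rightarrow> 'b) set" assume "Z \<in> Lp_cyl M p A r"
    from cyl[OF this] obtain z where z: "Z = Lp_class M p z" "z \<in> Lp_fun M p" "Lp_norm M p (restr A z) \<le> r"
      by auto
    show "nnorm (Lp M p) (Lp_class M p f \<boxminus>\<^bsub>Lp M p\<^esub> Lp_class M p ?y) \<le> nnorm (Lp M p) (Lp_class M p f \<boxminus>\<^bsub>Lp M p\<^esub> Z)"
      unfolding z(1) dist[OF y] dist[OF z(2)] using assms z by (intro cyl_proj_minimal)
  qed
  fix Z
  assume Z: "Z \<in> Lp_cyl M p A r \<and> (\<forall>W\<in>Lp_cyl M p A r.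
      nnorm (Lp M p) (Lp_class M p f \<boxminus>\<^bsub>Lp M p\<^esub> Z) \<le> nnorm (Lp M p) (Lp_class M p f \<boxminus>\<^bsub>Lp M p\<^esub> W))"
  then obtain z where z: "Z = Lp_class M p z" "z \<in> Lp_fun M p" "Lp_norm M p (restr A z) \<le> r"
    using cyl[of Z] by auto
  have "Lp_class M p ?y \<in> Lp_cyl M p A r"
    using Lp_class_in_Lp_cyl_iff[OF y assms(4)] y_cyl by blast
  \<comment> \<open>The competitor \<open>Z\<close> is minimal, so it is compared with the explicit
    projection.\<close>
  then have "Lp_norm M p (\<lambda>s. f s - z s) \<le> Lp_norm M p (\<lambda>s. f s - ?y s)"
    using Z unfolding z(1) by (metis dist[OF y] dist[OF z(2)])
  then have "AE s in M. ?y s = z s"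
    using cyl_projection_unique[OF assms(1,2,5) y z(2) assms(4) y_cyl _ z(3)]
      cyl_proj_minimal[OF assms(2,3,5) _ assms(4)] by blast
  then have "Lp_class M p ?y = Lp_class M p z" using Lp_class_eq_iff[OF y z(2)] by blast
  then show "Z = Lp_class M p ?y" using z(1) by simp
qed

section \<open>Directional and Frechet derivatives through representatives\<close>

text \<open>\<open>\<Phi>\<close> is a lift of \<open>F\<close> to functions, which lets difference
  quotients of \<open>F\<close> be computed without choosing representatives.\<close>

lemma diff_quot_Lp_class:
  assumes "1 < p" "\<And>f. f \<in> Lp_fun M p \<Longrightarrow> \<Phi> f \<in> Lp_fun M p"
    and "\<And>f. f \<in> Lp_fun M p \<Longrightarrow> F (Lp_class M p f) = Lp_class M p (\<Phi> f)"
    and "f \<in> Lp_fun M p" "v \<in> Lp_fun M p"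
  shows "diff_quot (Lp M p) F (Lp_class M p f) (Lp_class M p v) t
    = Lp_class M p (\<lambda>s. (1 / t) *\<^sub>R (\<Phi> (\<lambda>s. f s + t *\<^sub>R v s) s - \<Phi> f s))"
proof -
  have "(\<lambda>s. f s + t *\<^sub>R v s) \<in> Lp_fun M p" using assms by (intro Lp_fun_intros)
  then show ?thesis
    using assms
    by (simp add: diff_quot_def nscale_Lp_class nadd_Lp_class nminus_Lp_class Lp_fun_scaleR Lp_fun_diff)
qed

text \<open>The distance of two candidate derivatives is at most the sum of their distances to the
  quotient, which tends to 0. This is what makes the \<open>THE\<close> in \<open>dir_deriv\<close>
  meaningful.\<close>

lemma has_dir_deriv_Lp_unique:
  fixes \<Phi> :: "('a \<Rightarrow> 'b::real_normed_vector) \<Rightarrow> 'a \<Rightarrow> 'b"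
  assumes "1 < p" "\<And>f. f \<in> Lp_fun M p \<Longrightarrow> \<Phi> f \<in> Lp_fun M p"
    and "\<And>f. f \<in> Lp_fun M p \<Longrightarrow> F (Lp_class M p f) = Lp_class M p (\<Phi> f)"
    and "f \<in> Lp_fun M p" "v \<in> Lp_fun M p"
    and D: "has_dir_deriv (Lp M p) F (Lp_class M p f) (Lp_class M p v) D"
    and E: "has_dir_deriv (Lp M p) F (Lp_class M p f) (Lp_class M p v) E"
  shows "D = E"
proof -
  obtain d e where d: "d \<in> Lp_fun M p" "D = Lp_class M p d" and e: "e \<in> Lp_fun M p" "E = Lp_class M p e"
    using D E by (auto simp: has_dir_deriv_def points_Lp)
  define q where "q t = (\<lambda>s. (1 / t) *\<^sub>R (\<Phi> (\<lambda>s. f s + t *\<^sub>R v s) s - \<Phi> f s))" for t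
  have q: "q t \<in> Lp_fun M p" for t
    unfolding q_def using assms(1-5) by (intro Lp_fun_intros assms(2))
  have quot: "diff_quot (Lp M p) F (Lp_class M p f) (Lp_class M p v) t = Lp_class M p (q t)" for t
    unfolding q_def by (rule diff_quot_Lp_class[where \<Phi> = \<Phi> and F = F, OF assms(1-5)])
  have lim: "((\<lambda>t. Lp_norm M p (\<lambda>s. q t s - d s)) \<longlongrightarrow> 0) (at_right 0)"
    "((\<lambda>t. Lp_norm M p (\<lambda>s. q t s - e s)) \<longlongrightarrow> 0) (at_right 0)"
    using D E assms(1) d e q
    by (simp_all add: has_dir_deriv_def quot nminus_Lp_class nnorm_Lp_class Lp_fun_diff)
  have "Lp_norm M p (\<lambda>s. d s - e s) \<le> Lp_norm M p (\<lambda>s. q t s - d s) + Lp_norm M p (\<lambda>s. q t s - e s)" for t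
  proof -
    have "(\<lambda>s. d s - e s) = (\<lambda>s. (-1) *\<^sub>R (q t s - d s) + 1 *\<^sub>R (q t s - e s))" by simp
    then show ?thesis
      using Lp_norm_lincomb_le[OF assms(1) Lp_fun_diff[OF assms(1) q d(1)] Lp_fun_diff[OF assms(1) q e(1)], of "-1" t 1 t]
      by simp
  qed
  \<comment> \<open>The left side does not depend on \<open>t\<close>, so it is bounded by the limit
    of the right side.\<close>
  then have "Lp_norm M p (\<lambda>s. d s - e s) \<le> 0 + 0"
    by (intro tendsto_lowerbound[OF tendsto_add[OF lim]]) auto
  then have "Lp_norm M p (\<lambda>s. d s - e s) = 0"
    using Lp_norm_nonneg[of M p "\<lambda>s. d s - e s"] by linarith
  then show ?thesis
    using assms(1) d e by (simp add: Lp_norm_eq_0_iff Lp_fun_diff Lp_class_eq_iff)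
qed

text \<open>Uniform approximation on every ball serves twice: a ball containing a fixed
  \<open>v\<close> gives the directional derivative, and the unit ball gives uniformity on the unit
  sphere.\<close>

lemma frechet_differentiable_at_LpI:
  fixes \<Phi> :: "('a \<Rightarrow> 'b::real_normed_vector) \<Rightarrow> 'a \<Rightarrow> 'b"
  assumes "1 < p" "\<And>f. f \<in> Lp_fun M p \<Longrightarrow> \<Phi> f \<in> Lp_fun M p"
    and "\<And>f. f \<in> Lp_fun M p \<Longrightarrow> F (Lp_class M p f) = Lp_class M p (\<Phi> f)"
    and "f \<in> Lp_fun M p" "\<And>v. v \<in> Lp_fun M p \<Longrightarrow> d v \<in> Lp_fun M p"
    and approx: "\<And>R e. 0 < R \<Longrightarrow> 0 < e \<Longrightarrow>
      \<exists>\<delta>>0. \<forall>v\<in>Lp_fun M p. Lp_norm M p v \<le> R \<longrightarrow> (\<forall>t\<in>{0<..<\<delta>}.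
        Lp_norm M p (\<lambda>s. (1 / t) *\<^sub>R (\<Phi> (\<lambda>s. f s + t *\<^sub>R v s) s - \<Phi> f s) - d v s) < e)"
  shows "frechet_differentiable_at (Lp M p) F (Lp_class M p f)"
    and "\<And>v. v \<in> Lp_fun M p \<Longrightarrow> dir_deriv (Lp M p) F (Lp_class M p f) (Lp_class M p v) = Lp_class M p (d v)"
proof -
  let ?err = "\<lambda>v t. nnorm (Lp M p) (diff_quot (Lp M p) F (Lp_class M p f) (Lp_class M p v) t \<boxminus>\<^bsub>Lp M p\<^esub> Lp_class M p (d v))"
  have err: "?err v t = Lp_norm M p (\<lambda>s. (1 / t) *\<^sub>R (\<Phi> (\<lambda>s. f s + t *\<^sub>R v s) s - \<Phi> f s) - d v s)"
    if v: "v \<in> Lp_fun M p" for v t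
  proof -
    have q: "(\<lambda>s. (1 / t) *\<^sub>R (\<Phi> (\<lambda>s. f s + t *\<^sub>R v s) s - \<Phi> f s)) \<in> Lp_fun M p"
      using assms(1-4) v by (intro Lp_fun_intros assms(2))
    have "?err v t = nnorm (Lp M p) (Lp_class M p (\<lambda>s. (1 / t) *\<^sub>R (\<Phi> (\<lambda>s. f s + t *\<^sub>R v s) s - \<Phi> f s)) \<boxminus>\<^bsub>Lp M p\<^esub> Lp_class M p (d v))"
      by (simp only: diff_quot_Lp_class[where \<Phi> = \<Phi> and F = F, OF assms(1-4) v])
    also have "\<dots> = nnorm (Lp M p) (Lp_class M p (\<lambda>s. (1 / t) *\<^sub>R (\<Phi> (\<lambda>s. f s + t *\<^sub>R v s) s - \<Phi> f s) - d v s))"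
      by (simp only: nminus_Lp_class[OF assms(1) q assms(5)[OF v]])
    also have "\<dots> = Lp_norm M p (\<lambda>s. (1 / t) *\<^sub>R (\<Phi> (\<lambda>s. f s + t *\<^sub>R v s) s - \<Phi> f s) - d v s)"
      by (rule nnorm_Lp_class[OF Lp_fun_diff[OF assms(1) q assms(5)[OF v]]])
    finally show ?thesis .
  qed
  have has: "has_dir_deriv (Lp M p) F (Lp_class M p f) (Lp_class M p v) (Lp_class M p (d v))"
    if v: "v \<in> Lp_fun M p" for v
    unfolding has_dir_deriv_def
  proof
    show "Lp_class M p (d v) \<in> points (Lp M p)" using assms(5)[OF v] by (simp add: points_Lp)
    show "(?err v \<longlongrightarrow> 0) (at_right 0)"
    proof (rule tendstoI)
      fix e :: real assume "0 < e"
      \<comment> \<open>The summand 1 keeps \<open>R\<close> positive when \<open>v\<close> has norm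
        0.\<close>
      define R where "R = Lp_norm M p v + 1"
      have R: "0 < R" "Lp_norm M p v \<le> R"
        using Lp_norm_nonneg[of M p v] unfolding R_def by linarith+
      from approx[OF R(1) \<open>0 < e\<close>] obtain \<delta> where "\<delta> > 0" and
        \<delta>: "\<forall>v\<in>Lp_fun M p. Lp_norm M p v \<le> R \<longrightarrow> (\<forall>t\<in>{0<..<\<delta>}.
          Lp_norm M p (\<lambda>s. (1 / t) *\<^sub>R (\<Phi> (\<lambda>s. f s + t *\<^sub>R v s) s - \<Phi> f s) - d v s) < e)"
        by (elim exE conjE)
      have "dist (?err v t) 0 < e" if "t \<in> {0<..<\<delta>}" for t
        using \<delta>[rule_format, OF v R(2) that] unfolding err[OF v] by simp
      then show "\<forall>\<^sub>F t in at_right 0. dist (?err v t) 0 < e"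
        using \<open>\<delta> > 0\<close> by (intro eventually_at_rightI[of 0 \<delta>]) auto
    qed
  qed
  show deriv: "dir_deriv (Lp M p) F (Lp_class M p f) (Lp_class M p v) = Lp_class M p (d v)"
    if v: "v \<in> Lp_fun M p" for v
    unfolding dir_deriv_def
    using has[OF v] has_dir_deriv_Lp_unique[where \<Phi> = \<Phi> and F = F, OF assms(1-4) v] by (intro the_equality) auto
  show "frechet_differentiable_at (Lp M p) F (Lp_class M p f)"
    unfolding frechet_differentiable_at_def
  proof (intro conjI allI impI)
    show "dir_differentiable_at (Lp M p) F (Lp_class M p f)"
      using has by (auto simp: dir_differentiable_at_def points_Lp)
    fix e :: real assume "0 < e"
    from approx[OF zero_less_one \<open>0 < e\<close>] obtain \<delta> where "\<delta> > 0" and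
      \<delta>: "\<forall>v\<in>Lp_fun M p. Lp_norm M p v \<le> 1 \<longrightarrow> (\<forall>t\<in>{0<..<\<delta>}.
        Lp_norm M p (\<lambda>s. (1 / t) *\<^sub>R (\<Phi> (\<lambda>s. f s + t *\<^sub>R v s) s - \<Phi> f s) - d v s) < e)"
      by (elim exE conjE)
    show "\<exists>\<delta>>0. \<forall>V\<in>points (Lp M p). nnorm (Lp M p) V = 1 \<longrightarrow> (\<forall>t\<in>{0<..<\<delta>}.
        nnorm (Lp M p) (diff_quot (Lp M p) F (Lp_class M p f) V t \<boxminus>\<^bsub>Lp M p\<^esub>
          dir_deriv (Lp M p) F (Lp_class M p f) V) < e)"
    proof (intro exI[of _ \<delta>] conjI ballI impI)
      fix V :: "('a \<Rightarrow> 'b) set" and t assume V: "V \<in> points (Lp M p)" "nnorm (Lp M p) V = 1" and t: "t \<in> {0<..<\<delta>}"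
      then obtain v where v: "v \<in> Lp_fun M p" "V = Lp_class M p v" by (auto simp: points_Lp)
      then have "Lp_norm M p v \<le> 1" using V by (simp add: nnorm_Lp_class)
      from \<delta>[rule_format, OF v(1) this t]
      show "nnorm (Lp M p) (diff_quot (Lp M p) F (Lp_class M p f) V t \<boxminus>\<^bsub>Lp M p\<^esub>
          dir_deriv (Lp M p) F (Lp_class M p f) V) < e"
        unfolding v(2) deriv[OF v(1)] err[OF v(1)] .
    qed (rule \<open>\<delta> > 0\<close>)
  qed
qed

section \<open>The derivative formula on classes and the main result\<close>

lemma cyl_proj_deriv_class:
  assumes "1 < p" "A \<in> sets M" "f \<in> Lp_fun M p" "v \<in> Lp_fun M p"
  shows "Lp_class M p (cyl_proj_deriv M p A r f v) =
    (r / nnorm (Lp_on M p A) (Lp_restrict M p A (Lp_class M p f))) \<odot>\<^bsub>Lp M p\<^esub>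
      (Lp_restrict M p A (Lp_class M p v) \<boxminus>\<^bsub>Lp M p\<^esub>
        (smoothness_fun (Lp M p) (Lp_restrict M p A (Lp_class M p f)) (Lp_restrict M p A (Lp_class M p v))
           / nnorm (Lp_on M p A) (Lp_restrict M p A (Lp_class M p f))) \<odot>\<^bsub>Lp M p\<^esub> Lp_restrict M p A (Lp_class M p f))
    \<boxplus>\<^bsub>Lp M p\<^esub> Lp_restrict M p (space M - A) (Lp_class M p v)"
proof -
  let ?a = "Lp_norm M p (restr A f)" and ?\<psi> = "Lp_smoothness_fun M p (restr A f) (restr A v)"
  let ?d = "\<lambda>s. (r / ?a) *\<^sub>R (restr A v s - (?\<psi> / ?a) *\<^sub>R restr A f s) + restr (space M - A) v s"
  have co: "space M - A \<in> sets M" using assms(2) by auto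
  note mem = Lp_fun_restr[OF assms(3,2)] Lp_fun_restr[OF assms(4,2)] Lp_fun_restr[OF assms(4) co]
  have scal: "(\<lambda>s. (?\<psi> / ?a) *\<^sub>R restr A f s) \<in> Lp_fun M p"
    by (intro Lp_fun_scaleR mem)
  have diff: "(\<lambda>s. restr A v s - (?\<psi> / ?a) *\<^sub>R restr A f s) \<in> Lp_fun M p"
    by (intro Lp_fun_diff scal mem assms)
  have scal2: "(\<lambda>s. (r / ?a) *\<^sub>R (restr A v s - (?\<psi> / ?a) *\<^sub>R restr A f s)) \<in> Lp_fun M p"
    by (intro Lp_fun_scaleR diff)
  have sum: "?d \<in> Lp_fun M p"
    by (intro Lp_fun_add scal2 mem assms)
  \<comment> \<open>The two functions may differ outside \<open>space M\<close>, since the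
    complement of \<open>A\<close> is taken within it; hence equality is claimed only almost
    everywhere.\<close>
  have "AE s in M. cyl_proj_deriv M p A r f v s = ?d s"
    by (rule AE_I2) (auto simp: cyl_proj_deriv_def)
  then have "Lp_class M p (cyl_proj_deriv M p A r f v) = Lp_class M p ?d"
    using Lp_class_eq_iff[OF cyl_proj_deriv_in_Lp_fun[OF assms(1,3,4,2)] sum] by blast
  then show ?thesis
    unfolding nnorm_Lp_on Lp_restrict_class[OF assms(3,2)] Lp_restrict_class[OF assms(4,2)]
      Lp_restrict_class[OF assms(4) co] nnorm_Lp_class[OF mem(1)] smoothness_fun_Lp_class[OF assms(1) mem(1,2)]
      nscale_Lp_class[OF mem(1)] nminus_Lp_class[OF assms(1) mem(2) scal] nscale_Lp_class[OF diff]
      nadd_Lp_class[OF assms(1) scal2 mem(3)] .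
qed

text \<open>By homogeneity the norm has derivative equal to itself in the radial direction, so the
  two terms on \<open>A\<close> cancel.\<close>

lemma cyl_proj_deriv_self:
  assumes "1 < p" "A \<in> sets M" "f \<in> Lp_fun M p" "Lp_norm M p (restr A f) \<noteq> 0"
  shows "cyl_proj_deriv M p A r f f = (\<lambda>s. if s \<in> A then 0 else f s)"
  using assms(4) Lp_smoothness_fun_self[OF assms(1) Lp_fun_restr[OF assms(3,2)]]
  by (auto simp: cyl_proj_deriv_def)

theorem theorem5p6:
  fixes M :: "'a measure" and p r :: real and A :: "'a set"
    and L :: "('a \<Rightarrow> 'b::banach) set nspace"
    and C Co :: "('a \<Rightarrow> 'b) set set"
    and P :: "('a \<Rightarrow> 'b) set \<Rightarrow> ('a \<Rightarrow> 'b) set"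
  defines "L \<equiv> Lp M p"
    and "C \<equiv> Lp_cyl M p A r"
    and "Co \<equiv> Lp_open_cyl M p A r"
    and "P \<equiv> metric_proj L C"
  assumes "uniformly_convex TYPE('b)" and "uniformly_smooth TYPE('b)"
    and "1 < p"
    and "A \<in> sets M" and "emeasure M A > 0"
    and "r > 0"
  shows "(frechet_differentiable_on L P Co \<and>
         (\<forall>g\<in>Co. \<forall>h\<in>points L - {\<theta>\<^bsub>L\<^esub>}. dir_deriv L P g h = h)) \<and>
         (frechet_differentiable_on L P (points L - C) \<and>
         (\<forall>g\<in>points L - C. \<forall>h\<in>points L - {\<theta>\<^bsub>L\<^esub>}.
            dir_deriv L P g h =
              (r / nnorm (Lp_on M p A) (Lp_restrict M p A g)) \<odot>\<^bsub>L\<^esub>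
                (Lp_restrict M p A h \<boxminus>\<^bsub>L\<^esub>
                  (smoothness_fun L (Lp_restrict M p A g) (Lp_restrict M p A h)
                     / nnorm (Lp_on M p A) (Lp_restrict M p A g)) \<odot>\<^bsub>L\<^esub> Lp_restrict M p A g)
              \<boxplus>\<^bsub>L\<^esub> Lp_restrict M p (space M - A) h) \<and>
         (\<forall>g\<in>points L - C. dir_deriv L P g g = Lp_restrict M p (space M - A) g))"
proof -
  note p = \<open>1 < p\<close> and A = \<open>A \<in> sets M\<close> and r = \<open>r > 0\<close>
  have P: "P (Lp_class M p f) = Lp_class M p (cyl_proj M p A r f)" if "f \<in> Lp_fun M p" for f
    unfolding P_def L_def C_def using metric_proj_Lp_cyl[OF assms(5) p r A that] .
  have inner: "frechet_differentiable_at L P (Lp_class M p f)"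
    "\<And>v. v \<in> Lp_fun M p \<Longrightarrow> dir_deriv L P (Lp_class M p f) (Lp_class M p v) = Lp_class M p v"
    if f: "f \<in> Lp_fun M p" "Lp_norm M p (restr A f) < r" for f
  proof -
    have "\<exists>\<delta>>0. \<forall>v\<in>Lp_fun M p. Lp_norm M p v \<le> R \<longrightarrow> (\<forall>t\<in>{0<..<\<delta>}.
        Lp_norm M p (\<lambda>s. (1 / t) *\<^sub>R (cyl_proj M p A r (\<lambda>s. f s + t *\<^sub>R v s) s - cyl_proj M p A r f s) - v s) < e)"
      if Re: "0 < R" "0 < e" for R e
    proof -
      obtain \<delta> where \<delta>: "\<delta> > 0" "\<And>v t. v \<in> Lp_fun M p \<Longrightarrow> Lp_norm M p v \<le> R \<Longrightarrow> t \<in> {0<..<\<delta>} \<Longrightarrow>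
          (\<lambda>s. (1 / t) *\<^sub>R (cyl_proj M p A r (\<lambda>s. f s + t *\<^sub>R v s) s - cyl_proj M p A r f s)) = v"
        using cyl_proj_inner_diff_quot[OF p f(1) A f(2) Re(1)] by blast
      have "Lp_norm M p (\<lambda>s. (1 / t) *\<^sub>R (cyl_proj M p A r (\<lambda>s. f s + t *\<^sub>R v s) s - cyl_proj M p A r f s) - v s) < e"
        if "v \<in> Lp_fun M p" "Lp_norm M p v \<le> R" "t \<in> {0<..<\<delta>}" for v t
        \<comment> \<open>The quotient equals \<open>v\<close> exactly, so the error has norm
          0.\<close>
        using fun_cong[OF \<delta>(2)[OF that]] Re(2) by simp
      then show ?thesis using \<delta>(1) by blast
    qed
    note * = frechet_differentiable_at_LpI[where \<Phi> = "cyl_proj M p A r" and F = P and d = "\<lambda>v. v",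
        OF p cyl_proj_in_Lp_fun[OF _ A] P f(1) _ this]
    show "frechet_differentiable_at L P (Lp_class M p f)"
      "\<And>v. v \<in> Lp_fun M p \<Longrightarrow> dir_deriv L P (Lp_class M p f) (Lp_class M p v) = Lp_class M p v"
      unfolding L_def by (rule *; assumption)+
  qed
  have outer: "frechet_differentiable_at L P (Lp_class M p f)"
    "\<And>v. v \<in> Lp_fun M p \<Longrightarrow>
      dir_deriv L P (Lp_class M p f) (Lp_class M p v) = Lp_class M p (cyl_proj_deriv M p A r f v)"
    if f: "f \<in> Lp_fun M p" "r < Lp_norm M p (restr A f)" for f
    unfolding L_def
    by (rule frechet_differentiable_at_LpI[where \<Phi> = "cyl_proj M p A r" and F = P
          and d = "cyl_proj_deriv M p A r f", OF p cyl_proj_in_Lp_fun[OF _ A] P f(1)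
          cyl_proj_deriv_in_Lp_fun[OF p f(1) _ A] cyl_proj_outer_diff_quot[OF assms(6) p f(1) A r f(2)]];
        assumption)+
  have Co: "\<exists>f. f \<in> Lp_fun M p \<and> Lp_norm M p (restr A f) < r \<and> g = Lp_class M p f" if "g \<in> Co" for g
  proof -
    have "g \<in> points (Lp M p)" using that by (simp add: Co_def Lp_open_cyl_def)
    then show ?thesis using that A by (auto simp: points_Lp Co_def Lp_class_in_Lp_open_cyl_iff)
  qed
  have compl: "\<exists>f. f \<in> Lp_fun M p \<and> r < Lp_norm M p (restr A f) \<and> g = Lp_class M p f" if "g \<in> points L - C" for g
    using that A by (auto simp: points_Lp L_def C_def Lp_class_in_Lp_cyl_iff not_le)
  show ?thesis
  proof (intro conjI ballI)
    show "frechet_differentiable_on L P Co"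
      unfolding frechet_differentiable_on_def using Co inner(1) by blast
    show "frechet_differentiable_on L P (points L - C)"
      unfolding frechet_differentiable_on_def using compl outer(1) by blast
    show "dir_deriv L P g h = h" if "g \<in> Co" "h \<in> points L - {\<theta>\<^bsub>L\<^esub>}" for g h
      using Co[OF that(1)] inner(2) that(2) by (auto simp: L_def points_Lp)
  next
    fix g h assume g: "g \<in> points L - C" and h: "h \<in> points L - {\<theta>\<^bsub>L\<^esub>}"
    obtain f where f: "f \<in> Lp_fun M p" "r < Lp_norm M p (restr A f)" "g = Lp_class M p f"
      using compl[OF g] by blast
    obtain v where v: "v \<in> Lp_fun M p" "h = Lp_class M p v"
      using h by (auto simp: L_def points_Lp)
    show "dir_deriv L P g h =
              (r / nnorm (Lp_on M p A) (Lp_restrict M p A g)) \<odot>\<^bsub>L\<^esub>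
                (Lp_restrict M p A h \<boxminus>\<^bsub>L\<^esub>
                  (smoothness_fun L (Lp_restrict M p A g) (Lp_restrict M p A h)
                     / nnorm (Lp_on M p A) (Lp_restrict M p A g)) \<odot>\<^bsub>L\<^esub> Lp_restrict M p A g)
              \<boxplus>\<^bsub>L\<^esub> Lp_restrict M p (space M - A) h"
      unfolding f(3) v(2) outer(2)[OF f(1,2) v(1)] unfolding L_def
      using cyl_proj_deriv_class[OF p A f(1) v(1)] .
  next
    fix g assume g: "g \<in> points L - C"
    obtain f where f: "f \<in> Lp_fun M p" "r < Lp_norm M p (restr A f)" "g = Lp_class M p f"
      using compl[OF g] by blast
    have co: "space M - A \<in> sets M" using A by auto
    \<comment> \<open>The norm of \<open>f\<close> on \<open>A\<close> exceeds \<open>r > 0\<close>,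
      so it is nonzero and the radial cancellation applies.\<close>
    have deriv: "cyl_proj_deriv M p A r f f = (\<lambda>s. if s \<in> A then 0 else f s)"
      using f r by (intro cyl_proj_deriv_self[OF p A]) auto
    have "AE s in M. cyl_proj_deriv M p A r f f s = restr (space M - A) f s"
      unfolding deriv by (rule AE_I2) auto
    then have "Lp_class M p (cyl_proj_deriv M p A r f f) = Lp_class M p (restr (space M - A) f)"
      using Lp_class_eq_iff[OF cyl_proj_deriv_in_Lp_fun[OF p f(1) f(1) A] Lp_fun_restr[OF f(1) co]] by blast
    then show "dir_deriv L P g g = Lp_restrict M p (space M - A) g"
      unfolding f(3) outer(2)[OF f(1,2) f(1)] Lp_restrict_class[OF f(1) co] .
  qed
qed

end
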